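(* For $j=1,2$ let $P^{(j)}=N_d(\mu_j,\Sigma_j)$ with $\Sigma_j$ positive definite and density $f_j$, let $\pi_1,\pi_2>0$ with $\pi_1+\pi_2=1$, and let $\delta\in(0,1/2)$. Then for every $x\in\mathbb{R}^d$, \[2\log\frac{\pi_1}{\mathrm{vol}_d(P^{(1)}_\delta)}-d_{\Sigma_1}(x,\mu_1)^2>2\log\frac{\pi_2}{\mathrm{vol}_d(P^{(2)}_\delta)}-d_{\Sigma_2}(x,\mu_2)^2\iff \pi_1f_1(x)>\pi_2f_2(x),\] i.e. the rule coincides with the classical quadratic discriminant (Bayes) rule. Moreover, if $P^{(j)}_n$ is the empirical measure of an i.i.d. sample of size $n$ from $P^{(j)}$, then for every bounded $K\subset\mathbb{R}^d$ and $j=1,2$, \[\sup_{x\in K}\Bigl|2\log\frac{\pi_j}{\mathrm{vol}_d(P^{(j)}_{n,\delta})}-M_\delta(x;P^{(j)}_n)^2-\Bigl(2\log\frac{\pi_j}{\mathrm{vol}_d(P^{(j)}_\delta)}-d_{\Sigma_j}(x,\mu_j)^2\Bigr)\Bigr|\to0\] in probability, where $M_\delta$ is computed with $F_n=\Phi$.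
   Context: $\Phi$ is the standard normal distribution function. $d_\Sigma(x,\mu)=\sqrt{(x-\mu)^\top\Sigma^{-1}(x-\mu)}$. $\mathrm{HD}(x;Q)=\inf_uQ(\{y\colon u^\top y\le u^\top x\})$, $Q_\delta=\{x\colon\mathrm{HD}(x;Q)\ge\delta\}$, $P^{(j)}_{n,\delta}=(P^{(j)}_n)_\delta$. $\mathrm{Ill}(x;K)=\mathrm{vol}_d(\mathrm{conv}(K\cup\{x\}))$. $g_d(t)=1+\frac{\Gamma(\frac d2+1)}{\sqrt\pi\Gamma(\frac{d+1}2)}\bigl(\frac td(1-t^{-2})^{\frac{d+1}2}-\int_0^{\arccos(1/t)}\sin^d s\,ds\bigr)$ on $[1,\infty)$ with inverse $g_d^{-1}$. $M_\delta(x;P_n)=\Phi^{-1}(1-\mathrm{HD}(x;P_n))$ if $\mathrm{HD}(x;P_n)\ge\delta$, and $M_\delta(x;P_n)=\Phi^{-1}(1-\delta)\,g_d^{-1}(\mathrm{Ill}(x;P_{n,\delta})/\mathrm{vol}_d(P_{n,\delta}))$ otherwise. *)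

theory Defs
  imports "HOL-Probability.Probability"
begin

definition pos_def_matrix :: "real^'n^'n \<Rightarrow> bool" where
  "pos_def_matrix S \<longleftrightarrow> transpose S = S \<and> (\<forall>v. v \<noteq> 0 \<longrightarrow> v \<bullet> (S *v v) > 0)"

definition mahal :: "real^'n^'n \<Rightarrow> real^'n \<Rightarrow> real^'n \<Rightarrow> real" where
  "mahal S x mu = sqrt ((x - mu) \<bullet> (matrix_inv S *v (x - mu)))"

definition gauss_density :: "real^'n \<Rightarrow> real^'n^'n \<Rightarrow> real^'n \<Rightarrow> real" where
  "gauss_density mu S x =
     exp (- ((mahal S x mu)\<^sup>2) / 2) / sqrt ((2 * pi) ^ CARD('n) * det S)"

definition gauss_measure :: "real^'n \<Rightarrow> real^'n^'n \<Rightarrow> (real^'n) measure" where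
  "gauss_measure mu S = density lborel (\<lambda>x. ennreal (gauss_density mu S x))"

text \<open>Halfspace (Tukey) depth w.r.t. a set function Q (a probability measure
  or an empirical measure): HD(x;Q) = inf_u Q {y. u.y <= u.x}.\<close>
definition HD :: "((real^'n) set \<Rightarrow> real) \<Rightarrow> real^'n \<Rightarrow> real" where
  "HD Q x = (INF u. Q {y. u \<bullet> y \<le> u \<bullet> x})"

definition depth_region :: "((real^'n) set \<Rightarrow> real) \<Rightarrow> real \<Rightarrow> (real^'n) set" where
  "depth_region Q \<delta> = {x. HD Q x \<ge> \<delta>}"

definition empirical :: "nat \<Rightarrow> (nat \<Rightarrow> real^'n) \<Rightarrow> (real^'n) set \<Rightarrow> real" where
  "empirical n xs A = real (card {i. i < n \<and> xs i \<in> A}) / real n"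

definition vol :: "(real^'n) set \<Rightarrow> real" where
  "vol A = measure lborel A"

definition Ill :: "real^'n \<Rightarrow> (real^'n) set \<Rightarrow> real" where
  "Ill x K = vol (convex hull (K \<union> {x}))"

definition Phi :: "real \<Rightarrow> real" where
  "Phi t = (LBINT s:{..t}. std_normal_density s)"

definition Phi_inv :: "real \<Rightarrow> real" where
  "Phi_inv p = (THE t. Phi t = p)"

definition g_fun :: "nat \<Rightarrow> real \<Rightarrow> real" where
  "g_fun d t = 1 + Gamma (real d / 2 + 1) / (sqrt pi * Gamma ((real d + 1) / 2)) *
     (t / real d * (1 - t powr (-2)) powr ((real d + 1) / 2)
      - integral {0..arccos (1 / t)} (\<lambda>s. sin s ^ d))"

definition g_inv :: "nat \<Rightarrow> real \<Rightarrow> real" where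
  "g_inv d s = (THE t. t \<ge> 1 \<and> g_fun d t = s)"

text \<open>M_delta(x;Q) (computed with F_n = Phi).\<close>
definition M_delta :: "real \<Rightarrow> ((real^'n) set \<Rightarrow> real) \<Rightarrow> real^'n \<Rightarrow> real" where
  "M_delta \<delta> Q x =
     (if HD Q x \<ge> \<delta> then Phi_inv (1 - HD Q x)
      else Phi_inv (1 - \<delta>) *
           g_inv CARD('n) (Ill x (depth_region Q \<delta>) / vol (depth_region Q \<delta>)))"

end

theory Submission
  imports Defs
begin

text \<open>
  A linear \<open>L\<close> with \<open>L L\<^sup>T = S\<close> turns the Gaussian into the standard one. Hence halfspaces
  have probability \<open>\<Phi>((a - u \<bullet> \<mu>) / \<surd>(u \<bullet> S u))\<close>, by Cauchy--Schwarz the halfspace depth of \<open>x\<close> is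
  \<open>\<Phi>(- d\<^sub>S(x, \<mu>))\<close>, and the depth region at level \<open>\<delta>\<close> is the Mahalanobis ball of radius
  \<open>r = \<Phi>\<^sup>-\<^sup>1(1 - \<delta>)\<close>, of volume proportional to \<open>\<surd>(det S)\<close>; this gives the Bayes rule.
  The hull of the unit ball and a point at distance \<open>t \<ge> 1\<close> is a solid of revolution with volume
  ratio \<open>g\<^sub>d(t)\<close>, so the illumination of \<open>x\<close> recovers \<open>d\<^sub>S(x, \<mu>) / r\<close> outside the region.

  For the convergence, finitely many brackets approximate all halfspaces, so by Hoeffding's inequality
  the empirical depth is uniformly close to the Gaussian depth outside an event of small probability.
  On the complement the empirical depth region lies between two Mahalanobis balls of radii close to
  \<open>r\<close>. Volume and illumination are monotone in the body, and \<open>\<Phi>\<close> and \<open>g\<^sub>d\<close> are strictly increasing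
  and continuous, which makes the score deviate by little, uniformly on bounded sets.
\<close>

subsection \<open>Affine images of Lebesgue measure and whitening\<close>

text \<open>The Jacobian of \<open>L\<close> is not computed as a determinant. Uniqueness of
  translation-invariant measures yields some factor \<open>c > 0\<close>, and the total mass one of
  the Gaussian, inherited from the law of a sample point, forces \<open>c = sqrt (det S)\<close>.
  \<open>L\<close> is not the symmetric square root of \<open>S\<close>: it is built so that one
  prescribed direction falls on a coordinate axis. Each computation prescribes its own direction,
  the normal of a halfspace or the ray from the centre to \<open>x\<close>, which takes the place of
  rotation invariance. The obstacle to convergence is that the empirical depth is an infimum over
  uncountably many random frequencies and that its depth region is a random set of unknown shape.
  All randomness is therefore confined to deviations on finitely many fixed sets; what follows is a
  deterministic statement about any set function whose depth is uniformly close to the Gaussian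
  depth. \<open>Phi_inv\<close> and \<open>g_inv\<close> are definite descriptions, so stability of
  the inverses is phrased as the existence of a nearby preimage; this is why \<open>g_fun\<close> is
  extended below 1.\<close>

lemma translation_invariant_emeasure_proportional:
  fixes N :: "'a::euclidean_space measure"
  assumes sets [measurable_cong]: "sets N = sets borel"
    and sf: "sigma_finite_measure N"
    and inv: "\<And>a. distr N borel (\<lambda>x. x + a) = N"
    and A [measurable]: "A \<in> sets borel" and B [measurable]: "B \<in> sets borel"
  shows "emeasure N A * emeasure lborel B = emeasure N B * emeasure lborel A"
proof -
  interpret N: sigma_finite_measure N by fact
  interpret pair_sigma_finite N lborel ..
  have lb1: "(\<integral>\<^sup>+y. indicator B (y + x) \<partial>lborel) = emeasure lborel B" for x :: 'a
  proof -
    have "(\<integral>\<^sup>+y. indicator B y \<partial>distr lborel borel ((+) x)) = (\<integral>\<^sup>+y. indicator B (x + y) \<partial>lborel)"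
      by (rule nn_integral_distr) auto
    then show ?thesis by (simp add: lborel_distr_plus add.commute)
  qed
  have lb2: "(\<integral>\<^sup>+y. indicator A (x - y) \<partial>lborel) = emeasure lborel A" for x :: 'a
  proof -
    have "lborel = distr lborel borel (\<lambda>y::'a. x - y)"
      using lborel_affine[of "-1" x] by (simp add: density_1)
    then have "emeasure lborel A = (\<integral>\<^sup>+y. indicator A y \<partial>distr lborel borel (\<lambda>y::'a. x - y))"
      by simp
    also have "\<dots> = (\<integral>\<^sup>+y. indicator A (x - y) \<partial>lborel)"
      by (rule nn_integral_distr) auto
    finally show ?thesis ..
  qed
  \<comment> \<open>Uniqueness of Haar measure: one double integral is evaluated in two ways.
    Integrating \<open>y\<close> first gives the left side; shifting \<open>x\<close> by
    \<open>y\<close>, which the invariance of \<open>N\<close> allows, and then integrating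
    \<open>y\<close> gives the right side.\<close>
  have "emeasure N A * emeasure lborel B
      = (\<integral>\<^sup>+x. \<integral>\<^sup>+y. indicator A x * indicator B (y + x) \<partial>lborel \<partial>N)"
    by (simp add: nn_integral_cmult lb1 nn_integral_multc)
  also have "\<dots> = (\<integral>\<^sup>+y. \<integral>\<^sup>+x. indicator A x * indicator B (y + x) \<partial>N \<partial>lborel)"
    by (rule Fubini'[symmetric]) measurable
  also have "\<dots> = (\<integral>\<^sup>+y. \<integral>\<^sup>+x. indicator A (x - y) * indicator B x \<partial>N \<partial>lborel)"
  proof (rule nn_integral_cong)
    fix y :: 'a
    have "(\<integral>\<^sup>+x. indicator A (x - y) * indicator B x \<partial>distr N borel (\<lambda>x. x + y))
      = (\<integral>\<^sup>+x. indicator A x * indicator B (x + y) \<partial>N)"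
      by (subst nn_integral_distr) auto
    then show "(\<integral>\<^sup>+x. indicator A x * indicator B (y + x) \<partial>N)
      = (\<integral>\<^sup>+x. indicator A (x - y) * indicator B x \<partial>N)"
      by (simp add: inv add.commute)
  qed
  also have "\<dots> = (\<integral>\<^sup>+x. \<integral>\<^sup>+y. indicator A (x - y) * indicator B x \<partial>lborel \<partial>N)"
    by (rule Fubini') measurable
  also have "\<dots> = emeasure N B * emeasure lborel A"
    by (simp add: nn_integral_multc lb2 nn_integral_cmult mult.commute)
  finally show ?thesis .
qed

text \<open>The image of \<open>lborel\<close> under \<open>T z = a + L z\<close> is translation
  invariant and finite on compact sets, hence proportional to \<open>lborel\<close>. The value of
  the factor is found later from the Gaussian density.\<close>

lemma lborel_affine_bij:
  fixes L :: "'a::euclidean_space \<Rightarrow> 'a"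
  assumes "linear L" "bij L"
  obtains c :: real where "c > 0"
    "\<And>f :: 'a \<Rightarrow> ennreal. f \<in> borel_measurable borel \<Longrightarrow>
       (\<integral>\<^sup>+x. f x \<partial>lborel) = ennreal c * (\<integral>\<^sup>+z. f (a + L z) \<partial>lborel)"
proof -
  define T where "T z = a + L z" for z
  obtain L' where L': "linear L'" "\<And>x. L' (L x) = x" "\<And>x. L (L' x) = x"
    using assms linear_injective_isomorphism[of L] by (auto simp: bij_def)
  have [continuous_intros]: "continuous_on X L" "continuous_on X L'" for X
    using assms(1) L'(1) by (auto intro: linear_continuous_on simp: linear_conv_bounded_linear)
  have [measurable]: "T \<in> borel_measurable borel"
    unfolding T_def by (intro borel_measurable_continuous_onI continuous_intros)
  define N where "N = distr lborel borel T"
  have sets_N [measurable_cong]: "sets N = sets borel" by (simp add: N_def)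
  \<comment> \<open>Preimages under \<open>T\<close> are images under its continuous inverse, so
    compact sets have compact preimages and \<open>N\<close> is locally finite.\<close>
  have vim: "T -` X = (\<lambda>x. L' (x - a)) ` X" for X
  proof -
    have "z \<in> (\<lambda>x. L' (x - a)) ` X" if "T z \<in> X" for z
      using that by (intro image_eqI[of _ _ "T z"]) (auto simp: T_def L')
    moreover have "T (L' (x - a)) = x" for x by (simp add: T_def L')
    ultimately show ?thesis by auto
  qed
  have cont': "continuous_on X (\<lambda>x. L' (x - a))" for X
    by (rule continuous_on_compose2[of UNIV L' X "\<lambda>x. x - a"]) (auto intro!: continuous_intros)
  have fin: "emeasure N X < \<infinity>" if "compact X" for X
  proof -
    have "X \<in> sets borel" using that by (simp add: borel_compact)
    then have "emeasure N X = emeasure lborel ((\<lambda>x. L' (x - a)) ` X)"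
      by (simp add: N_def emeasure_distr vim[symmetric])
    also have "\<dots> < \<infinity>"
      using that cont' by (intro emeasure_compact_finite compact_continuous_image)
    finally show ?thesis .
  qed
  have sf: "sigma_finite_measure N"
  proof
    have "(\<Union>n. cball (0::'a) (real n)) = UNIV"
      by (auto simp: real_arch_simple)
    then show "\<exists>A. countable A \<and> A \<subseteq> sets N \<and> \<Union> A = space N \<and> (\<forall>a\<in>A. emeasure N a \<noteq> \<infinity>)"
      using fin by (intro exI[of _ "range (\<lambda>n. cball 0 (real n))"]) (auto simp: N_def less_top)
  qed
  have inv: "distr N borel (\<lambda>x. x + b) = N" for b
  proof -
    have "distr N borel (\<lambda>x. x + b) = distr lborel borel (\<lambda>z. T z + b)"
      by (simp add: N_def distr_distr o_def)
    \<comment> \<open>A shift by \<open>b\<close> after \<open>T\<close> is a shift by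
      \<open>L' b\<close> before it.\<close>
    also have "(\<lambda>z. T z + b) = T \<circ> (+) (L' b)"
      using assms(1) by (auto simp: T_def fun_eq_iff L' linear_add)
    also have "distr lborel borel (T \<circ> (+) (L' b)) = distr (distr lborel borel ((+) (L' b))) borel T"
      by (simp add: distr_distr)
    finally show ?thesis by (simp add: lborel_distr_plus N_def)
  qed
  define C :: "'a set" where "C = cball 0 1"
  have C: "emeasure lborel C = ennreal (measure lborel C)" "measure lborel C > 0"
    using emeasure_lborel_cball_finite[of "0::'a" 1]
    by (auto simp: C_def emeasure_eq_ennreal_measure less_top)
  have Nfin: "emeasure N C = ennreal (measure N C)"
    using fin[of C] by (simp add: C_def emeasure_eq_ennreal_measure less_top)
  have key: "emeasure N X * emeasure lborel C = emeasure N C * emeasure lborel X" if "X \<in> sets borel" for X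
    by (rule translation_invariant_emeasure_proportional[OF sets_N sf inv that]) (simp add: C_def)
  \<comment> \<open>If the unit ball were \<open>N\<close>-null, proportionality applied to
    \<open>UNIV\<close> would make \<open>N\<close> vanish, but its total mass is infinite.\<close>
  have Npos: "measure N C > 0"
  proof (rule ccontr)
    assume "\<not> measure N C > 0"
    then have "measure N C = 0" by (simp add: not_less measure_le_0_iff)
    then have "emeasure N UNIV * emeasure lborel C = 0" using key[of UNIV] Nfin by simp
    moreover have "emeasure N UNIV = \<infinity>" by (simp add: N_def emeasure_distr)
    ultimately show False using C by simp
  qed
  define c where "c = measure lborel C / measure N C"
  have eq: "lborel = density N (\<lambda>_. ennreal c)"
  proof (rule measure_eqI)
    fix X :: "'a set" assume "X \<in> sets lborel"
    then have X [measurable]: "X \<in> sets borel" by simp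
    have "emeasure (density N (\<lambda>_. ennreal c)) X = ennreal c * emeasure N X"
      by (simp add: emeasure_density_const sets_N)
    also have "\<dots> = ennreal (1 / measure N C) * emeasure lborel C * emeasure N X"
      using Npos C by (simp add: c_def ennreal_mult'[symmetric])
    also have "\<dots> = ennreal (1 / measure N C) * (emeasure N C * emeasure lborel X)"
      by (simp only: mult.assoc mult.commute[of "emeasure lborel C"] key[OF X])
    also have "\<dots> = (ennreal (1 / measure N C) * ennreal (measure N C)) * emeasure lborel X"
      using Nfin by (simp add: mult_ac)
    also have "ennreal (1 / measure N C) * ennreal (measure N C) = 1"
      using Npos by (simp add: ennreal_mult'[symmetric])
    finally show "emeasure lborel X = emeasure (density N (\<lambda>_. ennreal c)) X" by simp
  qed (simp add: N_def)
  show ?thesis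
  proof (rule that)
    show "c > 0" using Npos C by (simp add: c_def)
    fix f :: "'a \<Rightarrow> ennreal" assume [measurable]: "f \<in> borel_measurable borel"
    have "(\<integral>\<^sup>+x. f x \<partial>lborel) = (\<integral>\<^sup>+x. f x \<partial>density N (\<lambda>_. ennreal c))"
      using eq by simp
    also have "\<dots> = ennreal c * (\<integral>\<^sup>+x. f x \<partial>N)"
      by (simp add: nn_integral_density nn_integral_cmult)
    also have "(\<integral>\<^sup>+x. f x \<partial>N) = (\<integral>\<^sup>+z. f (T z) \<partial>lborel)"
      unfolding N_def by (rule nn_integral_distr) auto
    finally show "(\<integral>\<^sup>+x. f x \<partial>lborel) = ennreal c * (\<integral>\<^sup>+z. f (a + L z) \<partial>lborel)"
      by (simp add: T_def)
  qed
qed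

section \<open>Positive definite matrices and the construction of the whitening map\<close>

lemma pos_def_matrix_inner_commute:
  "pos_def_matrix S \<Longrightarrow> v \<bullet> (S *v w) = w \<bullet> (S *v v)"
  by (metis pos_def_matrix_def dot_lmul_matrix inner_commute transpose_matrix_vector)

lemma pos_def_matrix_pos:
  "pos_def_matrix S \<Longrightarrow> v \<noteq> 0 \<Longrightarrow> v \<bullet> (S *v v) > 0"
  by (simp add: pos_def_matrix_def)

lemma pos_def_matrix_invertible:
  fixes S :: "real^'n^'n"
  assumes "pos_def_matrix S" shows "invertible S"
proof -
  have "S *v v = 0 \<Longrightarrow> v = 0" for v
    using pos_def_matrix_pos[OF assms, of v] by fastforce
  then show ?thesis
    using invertible_left_inverse matrix_left_invertible_ker by blast
qed

lemma matrix_inv_mult_vec: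
  fixes S :: "real^'n^'n"
  assumes "invertible S"
  shows "matrix_inv S *v (S *v x) = x" "S *v (matrix_inv S *v x) = x"
  using someI_ex[OF assms[unfolded invertible_def]]
  by (simp_all add: matrix_vector_mul_assoc flip: matrix_inv_def)

text \<open>Gram--Schmidt for the form \<open>v \<bullet> S w\<close>, started at a prescribed vector.\<close>

lemma pos_def_orthonormal_basis:
  fixes S :: "real^'n^'n"
  assumes S: "pos_def_matrix S" and u: "u \<noteq> 0"
  obtains b :: "'n \<Rightarrow> real^'n" where
    "\<And>i j. b i \<bullet> (S *v b j) = (if i = j then 1 else 0)"
    "b k = u /\<^sub>R sqrt (u \<bullet> (S *v u))"
proof -
  have unit: "(w /\<^sub>R sqrt (w \<bullet> (S *v w))) \<bullet> (S *v (w /\<^sub>R sqrt (w \<bullet> (S *v w)))) = 1" if "w \<noteq> 0" for w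
    using pos_def_matrix_pos[OF S that]
    by (simp add: matrix_vector_mult_scaleR field_simps)
  have "\<exists>b :: 'n \<Rightarrow> real^'n. (\<forall>i\<in>insert k I. \<forall>j\<in>insert k I. b i \<bullet> (S *v b j) = (if i = j then 1 else 0))
     \<and> b k = u /\<^sub>R sqrt (u \<bullet> (S *v u))" if "finite I" for I :: "'n set"
    using that
  proof (induction I)
    case empty
    show ?case using unit[OF u] by (intro exI[of _ "\<lambda>_. u /\<^sub>R sqrt (u \<bullet> (S *v u))"]) simp
  next
    case (insert i I)
    then obtain b where b: "\<And>i j. i \<in> insert k I \<Longrightarrow> j \<in> insert k I \<Longrightarrow> b i \<bullet> (S *v b j) = (if i = j then 1 else 0)"
      "b k = u /\<^sub>R sqrt (u \<bullet> (S *v u))" by blast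
    show ?case
    proof (cases "i = k")
      case True
      then show ?thesis using b by (intro exI[of _ b]) auto
    next
      case False
      define J where "J = insert k I"
      have J: "i \<notin> J" "finite J" "k \<in> J" using False insert by (auto simp: J_def)
      have bJ: "b p \<bullet> (S *v b q) = (if p = q then 1 else 0)" if "p \<in> J" "q \<in> J" for p q
        using b(1) that by (simp add: J_def)
      \<comment> \<open>Fewer than \<open>CARD('n)\<close> vectors do not span the space, so some
        \<open>v\<close> lies outside their span and its \<open>S\<close>-orthogonal residual
        \<open>w\<close> is nonzero.\<close>
      have "card J < CARD('n)"
        using J by (intro psubset_card_mono) auto
      then have "card (b ` J) < CARD('n)"
        using card_image_le[OF J(2), of b] by simp
      then have "dim (b ` J) < DIM(real^'n)"
        using dim_le_card'[of "b ` J"] J(2) by simp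
      then have "span (b ` J) \<noteq> UNIV" using dim_eq_full by force
      then obtain v where v: "v \<notin> span (b ` J)" by auto
      define w where "w = v - (\<Sum>j\<in>J. (b j \<bullet> (S *v v)) *\<^sub>R b j)"
      have "(\<Sum>j\<in>J. (b j \<bullet> (S *v v)) *\<^sub>R b j) \<in> span (b ` J)"
        by (intro span_sum span_scale span_base) auto
      then have w0: "w \<noteq> 0" using v by (auto simp: w_def)
      have bw: "b p \<bullet> (S *v w) = 0" if "p \<in> J" for p
      proof -
        have "b p \<bullet> (S *v w) = b p \<bullet> (S *v v) - (\<Sum>j\<in>J. (b j \<bullet> (S *v v)) * (b p \<bullet> (S *v b j)))"
          by (simp add: w_def matrix_vector_mult_diff_distrib inner_diff_right
            linear_sum[OF matrix_vector_mul_linear] matrix_vector_mult_scaleR inner_sum_right)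
        also have "(\<Sum>j\<in>J. (b j \<bullet> (S *v v)) * (b p \<bullet> (S *v b j))) = (\<Sum>j\<in>J. if p = j then b j \<bullet> (S *v v) else 0)"
          by (intro sum.cong) (auto simp: bJ that)
        also have "\<dots> = b p \<bullet> (S *v v)" using that J by simp
        finally show ?thesis by simp
      qed
      define w' where "w' = w /\<^sub>R sqrt (w \<bullet> (S *v w))"
      have w': "w' \<bullet> (S *v w') = 1" unfolding w'_def by (rule unit[OF w0])
      have bw': "b p \<bullet> (S *v w') = 0" "w' \<bullet> (S *v b p) = 0" if "p \<in> J" for p
        using bw[OF that] pos_def_matrix_inner_commute[OF S, of w "b p"]
        by (simp_all add: w'_def matrix_vector_mult_scaleR)
      have "insert k (insert i I) = insert i J" by (auto simp: J_def)
      then show ?thesis using b(2) J bJ bw' w'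
        by (intro exI[of _ "b(i := w')"]) auto
    qed
  qed
  from this[of UNIV] show ?thesis using that by auto
qed

text \<open>Whitening: \<open>L L\<^sup>T = S\<close>, with \<open>L\<^sup>T u\<close> on the \<open>k\<close>-th coordinate axis.\<close>

lemma pos_def_whitening:
  fixes S :: "real^'n^'n"
  assumes S: "pos_def_matrix S" and u: "u \<noteq> 0"
  obtains L :: "real^'n \<Rightarrow> real^'n" where
    "linear L" "bij L"
    "\<And>z. L z \<bullet> (matrix_inv S *v L z) = z \<bullet> z"
    "\<And>z. u \<bullet> L z = sqrt (u \<bullet> (S *v u)) * z $ k"
    "L (axis k 1) = (S *v u) /\<^sub>R sqrt (u \<bullet> (S *v u))"
proof -
  obtain b :: "'n \<Rightarrow> real^'n" where
    b: "\<And>i j. b i \<bullet> (S *v b j) = (if i = j then 1 else 0)" and bk: "b k = u /\<^sub>R sqrt (u \<bullet> (S *v u))"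
    using pos_def_orthonormal_basis[OF S u] by metis
  \<comment> \<open>\<open>B\<close> has the \<open>S\<close>-orthonormal vectors as columns, so
    \<open>B^T S B = 1\<close>; with \<open>L = S B\<close> this reads
    \<open>L^T S^-1 L = 1\<close>. Since \<open>u\<close> is a multiple of \<open>b k\<close>, its
    product with \<open>L z\<close> sees only the \<open>k\<close>-th coordinate.\<close>
  define B where "B z = (\<Sum>i\<in>UNIV. z $ i *\<^sub>R b i)" for z :: "real^'n"
  define L where "L z = S *v B z" for z
  have linB: "linear B"
    unfolding B_def by (intro linearI) (simp_all add: algebra_simps sum.distrib scaleR_sum_right)
  have linL: "linear L" unfolding L_def using linear_compose[OF linB, of "(*v) S"] by (simp add: o_def)
  have bB: "b i \<bullet> (S *v B z) = z $ i" for i z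
    by (simp add: B_def linear_sum[OF matrix_vector_mul_linear] matrix_vector_mult_scaleR
      inner_sum_right b if_distrib cong: if_cong)
  have BB: "B z \<bullet> (S *v B z) = z \<bullet> z" for z
  proof -
    have "B z \<bullet> (S *v B z) = (\<Sum>i\<in>UNIV. z $ i *\<^sub>R b i) \<bullet> (S *v B z)"
      by (simp only: B_def)
    also have "\<dots> = z \<bullet> z"
      by (simp add: inner_sum_left bB inner_vec_def[of z z])
    finally show ?thesis .
  qed
  have "inj B"
    using linB by (subst linear_injective_0) (auto, metis BB inner_eq_zero_iff inner_zero_left)
  moreover have "inj ((*v) S)"
    using matrix_inv_mult_vec(1)[OF pos_def_matrix_invertible[OF S]] by (metis injI)
  ultimately have "inj L" unfolding L_def by (meson injD injI)
  then have bijL: "bij L"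
    using linL linear_injective_imp_surjective unfolding bij_def by blast
  have \<sigma>: "sqrt (u \<bullet> (S *v u)) > 0" using pos_def_matrix_pos[OF S u] by simp
  have u_eq: "u = sqrt (u \<bullet> (S *v u)) *\<^sub>R b k" using \<sigma> by (simp add: bk)
  show ?thesis
  proof (rule that[OF linL bijL])
    show "L z \<bullet> (matrix_inv S *v L z) = z \<bullet> z" for z
      by (simp add: L_def matrix_inv_mult_vec pos_def_matrix_invertible[OF S] BB inner_commute)
    have "b k \<bullet> L z = z $ k" for z by (simp add: L_def bB)
    then show "u \<bullet> L z = sqrt (u \<bullet> (S *v u)) * z $ k" for z
      using u_eq inner_scaleR_left by metis
    have "B (axis k 1) = b k"
      by (simp add: B_def axis_def if_distrib[of "\<lambda>c. c *\<^sub>R _"] cong: if_cong)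
    then show "L (axis k 1) = (S *v u) /\<^sub>R sqrt (u \<bullet> (S *v u))"
      by (simp add: L_def bk matrix_vector_mult_scaleR)
  qed
qed

subsection \<open>The illumination function of the ball\<close>

text \<open>Fubini along \<open>e\<close>: the slice at height \<open>h\<close> is a ball of radius
  \<open>\<rho> h\<close> in the other coordinates. Positivity is asked only inside the interval
  because the profiles in question vanish at its ends.\<close>

lemma emeasure_solid_of_revolution:
  fixes e :: "'a::euclidean_space"
  assumes e: "e \<in> Basis" and [measurable]: "\<rho> \<in> borel_measurable borel"
    and pos: "\<And>h. a < h \<Longrightarrow> h < b \<Longrightarrow> \<rho> h > 0"
    and int: "((\<lambda>h. \<rho> h ^ (DIM('a) - 1)) has_integral I) {a..b}"
  shows "emeasure lborel {x. x \<bullet> e \<in> {a..b} \<and> norm (x - (x \<bullet> e) *\<^sub>R e) \<le> \<rho> (x \<bullet> e)}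
       = ennreal (unit_ball_vol (DIM('a) - 1) * I)"
proof -
  interpret product_sigma_finite "\<lambda>_::'a. lborel :: real measure" by standard
  define A where "A = Basis - {e}"
  have A: "finite A" "e \<notin> A" "insert e A = Basis" "card A = DIM('a) - 1"
    using e by (auto simp: A_def)
  let ?C = "{x. x \<bullet> e \<in> {a..b} \<and> norm (x - (x \<bullet> e) *\<^sub>R e) \<le> \<rho> (x \<bullet> e)}"
  let ?s = "\<lambda>f::'a \<Rightarrow> real. \<Sum>b\<in>Basis. f b *\<^sub>R b"
  have meas [measurable]: "?C \<in> sets borel" by measurable
  have nrm: "norm (?s f - f e *\<^sub>R e) = sqrt (\<Sum>i\<in>A. (f i)\<^sup>2)" for f
  proof -
    have "norm (?s f - f e *\<^sub>R e) = sqrt (\<Sum>i\<in>Basis. (if i = e then 0 else f i)\<^sup>2)"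
      unfolding norm_eq_sqrt_inner
      using e by (subst euclidean_inner, intro arg_cong[of _ _ sqrt] sum.cong refl)
        (auto simp: inner_diff_left inner_Basis power2_eq_square)
    also have "(\<Sum>i\<in>Basis. (if i = e then 0 else f i)\<^sup>2) = (\<Sum>i\<in>A. (f i)\<^sup>2)"
      unfolding A_def using e by (subst sum.remove[of _ e]) auto
    finally show ?thesis .
  qed
  let ?P = "Pi\<^sub>M Basis (\<lambda>_::'a. lborel :: real measure)"
  let ?PA = "Pi\<^sub>M A (\<lambda>_::'a. lborel :: real measure)"
  let ?D = "{f. f e \<in> {a..b} \<and> sqrt (\<Sum>i\<in>A. (f i)\<^sup>2) \<le> \<rho> (f e)} \<inter> space ?P"
  let ?B = "\<lambda>h. {f. sqrt (\<Sum>i\<in>A. (f i)\<^sup>2) \<le> \<rho> h} \<inter> space ?PA"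
  have Dmeas: "?D \<in> sets ?P"
  proof -
    have comp: "(\<lambda>f. f i) \<in> borel_measurable ?P" if "i \<in> Basis" for i
      using measurable_component_singleton[OF that, of "\<lambda>_. lborel"] by simp
    have "(\<lambda>f. sqrt (\<Sum>i\<in>A. (f i)\<^sup>2)) \<in> borel_measurable ?P"
      by (intro measurable_compose[OF _ borel_measurable_sqrt] borel_measurable_sum
        borel_measurable_power comp) (simp add: A_def)
    moreover have "(\<lambda>f. \<rho> (f e)) \<in> borel_measurable ?P"
      by (rule measurable_compose[OF comp[OF e]]) simp
    ultimately have "{f \<in> space ?P. f e \<in> {a..b} \<and> sqrt (\<Sum>i\<in>A. (f i)\<^sup>2) \<le> \<rho> (f e)} \<in> sets ?P"
      unfolding atLeastAtMost_iff
      by (intro sets.sets_Collect_conj borel_measurable_le comp[OF e] borel_measurable_const)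
    also have "{f \<in> space ?P. f e \<in> {a..b} \<and> sqrt (\<Sum>i\<in>A. (f i)\<^sup>2) \<le> \<rho> (f e)} = ?D" by auto
    finally show ?thesis .
  qed
  have Bmeas [measurable]: "?B h \<in> sets ?PA" for h
  proof -
    have "{f \<in> space ?PA. sqrt (\<Sum>i\<in>A. (f i)\<^sup>2) \<le> \<rho> h} \<in> sets ?PA"
      by measurable
    also have "{f \<in> space ?PA. sqrt (\<Sum>i\<in>A. (f i)\<^sup>2) \<le> \<rho> h} = ?B h" by auto
    finally show ?thesis .
  qed
  have "emeasure lborel ?C = emeasure (distr ?P borel ?s) ?C"
    by (subst lborel_eq[symmetric]) simp
  also have "\<dots> = emeasure ?P ({f. ?s f \<in> ?C} \<inter> space ?P)"
    by (subst emeasure_distr) (auto simp: vimage_def)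
  also have "{f. ?s f \<in> ?C} \<inter> space ?P = ?D"
    using e nrm by auto
  also have "emeasure ?P ?D = (\<integral>\<^sup>+f. indicator ?D f \<partial>Pi\<^sub>M (insert e A) (\<lambda>_. lborel))"
    using Dmeas A(3) by simp
  also have "\<dots> = (\<integral>\<^sup>+h. \<integral>\<^sup>+f. indicator ?D (f(e := h)) \<partial>?PA \<partial>lborel)"
    using Dmeas A by (subst product_nn_integral_insert_rev) auto
  also have "\<dots> = (\<integral>\<^sup>+h. \<integral>\<^sup>+f. indicator {a..b} h * indicator (?B h) f \<partial>?PA \<partial>lborel)"
  proof (intro nn_integral_cong)
    fix h :: real and f assume f: "f \<in> space ?PA"
    have "(\<Sum>i\<in>A. (if i = e then h else f i)\<^sup>2) = (\<Sum>i\<in>A. (f i)\<^sup>2)"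
      using A by (intro sum.cong) auto
    moreover have "f(e := h) \<in> space ?P"
      using f A by (auto simp: space_PiM PiE_def extensional_def)
    ultimately show "indicator ?D (f(e := h)) = (indicator {a..b} h * indicator (?B h) f :: ennreal)"
      using f by (auto simp: indicator_def)
  qed
  also have "\<dots> = (\<integral>\<^sup>+h. indicator {a..b} h * emeasure ?PA (?B h) \<partial>lborel)"
    by (simp add: nn_integral_cmult)
  also have "\<dots> = (\<integral>\<^sup>+h. ennreal (unit_ball_vol (DIM('a) - 1) * \<rho> h ^ (DIM('a) - 1)) * indicator {a<..<b} h \<partial>lborel)"
  proof (intro nn_integral_cong_AE)
    \<comment> \<open>The ball volume formula wants a positive radius, so the two end heights are
      discarded as a null set.\<close>
    have "AE h in lborel. h \<notin> {a, b}"
      by (intro AE_not_in countable_imp_null_set_lborel) auto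
    then show "AE h in lborel. indicator {a..b} h * emeasure ?PA (?B h) =
       ennreal (unit_ball_vol (DIM('a) - 1) * \<rho> h ^ (DIM('a) - 1)) * indicator {a<..<b} h"
      by eventually_elim (use emeasure_cball_aux[OF A(1) pos] A(4) in \<open>auto simp: indicator_def\<close>)
  qed
  also have "\<dots> = ennreal (unit_ball_vol (DIM('a) - 1) * I)"
  proof (rule nn_integral_has_integral_lebesgue')
    show "((\<lambda>h. unit_ball_vol (DIM('a) - 1) * \<rho> h ^ (DIM('a) - 1)) has_integral unit_ball_vol (DIM('a) - 1) * I) {a<..<b}"
      using has_integral_Icc_iff_Ioo int by (intro has_integral_mult_right) blast
    fix h assume "h \<in> {a<..<b}"
    then show "0 \<le> unit_ball_vol (DIM('a) - 1) * \<rho> h ^ (DIM('a) - 1)"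
      using pos[of h] by auto
  qed
  finally show ?thesis .
qed

text \<open>Beyond height \<open>1/t\<close> the hull is the cone with apex \<open>t e\<close> tangent to the ball.\<close>

definition ice_cream_radius :: "real \<Rightarrow> real \<Rightarrow> real" where
  "ice_cream_radius t h = (if h \<le> 1 / t then sqrt (1 - h\<^sup>2) else (t - h) / sqrt (t\<^sup>2 - 1))"

lemma convex_hull_cball_insert_eq:
  fixes e :: "'a::euclidean_space"
  assumes e: "norm e = 1" and t: "t > 1"
  shows "convex hull (cball 0 1 \<union> {t *\<^sub>R e})
    = {x. x \<bullet> e \<in> {-1..t} \<and> norm (x - (x \<bullet> e) *\<^sub>R e) \<le> ice_cream_radius t (x \<bullet> e)}" (is "?L = ?R")
proof -
  have ee: "e \<bullet> e = 1" using e by (simp add: norm_eq_1)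
  define y where "y x = x - (x \<bullet> e) *\<^sub>R e" for x
  have pyth: "x \<bullet> x = (x \<bullet> e)\<^sup>2 + (norm (y x))\<^sup>2" for x
  proof -
    have "(norm (y x))\<^sup>2 = y x \<bullet> y x" by (simp add: power2_norm_eq_inner)
    then show ?thesis
      by (simp add: y_def inner_diff_left inner_diff_right ee inner_commute power2_eq_square)
  qed
  define w where "w = sqrt (t\<^sup>2 - 1)"
  have w: "w > 0" "w\<^sup>2 = t\<^sup>2 - 1" using t by (auto simp: w_def one_less_power)
  \<comment> \<open>The supporting inequality of the tangent cone is Cauchy--Schwarz in the plane
    for \<open>(norm (y b), b \<bullet> e)\<close> and \<open>(w, 1)\<close>, where
    \<open>w\<^sup>2 + 1 = t\<^sup>2\<close>; the second square below is the Lagrange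
    remainder.\<close>
  have ball_ineq: "norm (y b) * w + b \<bullet> e \<le> t" if "b \<bullet> b \<le> 1" for b
  proof -
    have "(norm (y b) * w + b \<bullet> e)\<^sup>2 + (norm (y b) - w * (b \<bullet> e))\<^sup>2 = ((norm (y b))\<^sup>2 + (b \<bullet> e)\<^sup>2) * (w\<^sup>2 + 1)"
      by (simp add: power2_eq_square algebra_simps)
    also have "\<dots> = (b \<bullet> b) * t\<^sup>2" by (simp add: w pyth[of b] add.commute)
    also have "\<dots> \<le> 1 * t\<^sup>2" by (rule mult_right_mono) (use that in auto)
    finally have "(norm (y b) * w + b \<bullet> e)\<^sup>2 \<le> t\<^sup>2" using zero_le_power2[of "norm (y b) - w * (b \<bullet> e)"] by linarith
    then show ?thesis by (rule power2_le_imp_le) (use t in simp)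
  qed
  show ?thesis
  proof (intro set_eqI iffI)
    fix x assume "x \<in> ?L"
    moreover have "cball 0 1 \<union> {t *\<^sub>R e} = insert (t *\<^sub>R e) (cball (0::'a) 1)" by auto
    ultimately obtain s v b where sv: "s \<ge> 0" "v \<ge> 0" "s + v = 1" "b \<in> convex hull (cball 0 1)" "x = s *\<^sub>R (t *\<^sub>R e) + v *\<^sub>R b"
      by (auto simp: convex_hull_insert)
    have "convex hull (cball 0 1) = cball (0::'a) 1" by (simp add: convex_hull_eq)
    then have b: "norm b \<le> 1" "b \<bullet> b \<le> 1" using sv(4) by (auto simp: norm_le_square)
    have h: "x \<bullet> e = s * t + v * (b \<bullet> e)" by (simp add: sv(5) inner_add_left ee)
    have yx: "y x = v *\<^sub>R y b" by (simp add: y_def sv(5) inner_add_left ee algebra_simps)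
    have "norm (y x) * w + x \<bullet> e = v * (norm (y b) * w + b \<bullet> e) + s * t"
      using sv(2) by (simp only: yx h norm_scaleR) (simp add: algebra_simps)
    also have "\<dots> \<le> v * t + s * t" using ball_ineq[OF b(2)] sv by (simp add: mult_left_mono)
    also have "\<dots> = t" using sv(3) by (metis add.commute distrib_right mult_1)
    finally have le: "norm (y x) * w + x \<bullet> e \<le> t" .
    then have ht: "x \<bullet> e \<le> t" using mult_nonneg_nonneg[OF norm_ge_zero[of "y x"] less_imp_le[OF w(1)]] by linarith
    have cone: "norm (y x) \<le> (t - x \<bullet> e) / w" using le w by (simp add: field_simps)
    have be: "b \<bullet> e \<ge> -1"
      using Cauchy_Schwarz_ineq2[of b e] b e by (simp add: abs_le_iff)
    have "x \<bullet> e \<ge> s * (-1) + v * (-1)"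
      unfolding h using sv t be by (intro add_mono mult_left_mono) auto
    then have h1: "x \<bullet> e \<ge> -1" using sv by simp
    \<comment> \<open>Up to the height of tangency the hull stays in the ball: expanding
      \<open>v\<^sup>2 * (b \<bullet> b)\<close> and using
      \<open>t * (x \<bullet> e) \<le> 1\<close> gives
      \<open>x \<bullet> x \<le> (1 - s)\<^sup>2 + 2 * s - s\<^sup>2 = 1\<close>.\<close>
    have cap: "norm (y x) \<le> sqrt (1 - (x \<bullet> e)\<^sup>2)" if le1: "x \<bullet> e \<le> 1 / t"
    proof -
      have "x \<bullet> x \<le> 1"
      proof (rule ccontr)
        assume "\<not> x \<bullet> x \<le> 1"
        then have gt: "x \<bullet> x > 1" by simp
        have th: "t * (x \<bullet> e) \<le> 1" using le1 t by (simp add: field_simps)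
        have "v *\<^sub>R b = x - (s * t) *\<^sub>R e" by (simp add: sv(5))
        then have "(v *\<^sub>R b) \<bullet> (v *\<^sub>R b) = (x - (s * t) *\<^sub>R e) \<bullet> (x - (s * t) *\<^sub>R e)" by simp
        also have "\<dots> = x \<bullet> x - 2 * s * (t * (x \<bullet> e)) + s\<^sup>2 * t\<^sup>2"
          by (simp add: inner_diff_left inner_diff_right ee inner_commute[of e x] power2_eq_square algebra_simps)
        finally have "(v *\<^sub>R b) \<bullet> (v *\<^sub>R b) = x \<bullet> x - 2 * s * (t * (x \<bullet> e)) + s\<^sup>2 * t\<^sup>2" .
        then have "v\<^sup>2 * (b \<bullet> b) = x \<bullet> x - 2 * s * (t * (x \<bullet> e)) + s\<^sup>2 * t\<^sup>2"
          by (simp add: power2_eq_square)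
        moreover have "s * (t * (x \<bullet> e)) \<le> s * 1" using sv th by (intro mult_left_mono)
        moreover have "s\<^sup>2 * 1 \<le> s\<^sup>2 * t\<^sup>2" using t by (intro mult_left_mono) (auto simp: one_le_power)
        moreover have "v\<^sup>2 * (b \<bullet> b) \<le> v\<^sup>2 * 1" using b by (intro mult_left_mono) auto
        moreover have "v\<^sup>2 = 1 - 2 * s + s\<^sup>2"
        proof -
          have "v = 1 - s" using sv by simp
          show ?thesis unfolding \<open>v = 1 - s\<close> by (simp add: power2_eq_square algebra_simps)
        qed
        ultimately show False using gt by linarith
      qed
      then show ?thesis using pyth[of x] by (intro real_le_rsqrt) simp
    qed
    show "x \<in> ?R" using h1 ht cone cap by (auto simp: ice_cream_radius_def y_def w_def)
  next
    fix x assume x: "x \<in> ?R"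
    have sub: "cball 0 1 \<subseteq> ?L" "t *\<^sub>R e \<in> ?L" using hull_subset[of "cball 0 1 \<union> {t *\<^sub>R e}" convex] by auto
    show "x \<in> ?L"
    proof (cases "x \<bullet> e \<le> 1 / t")
      case True
      then have n: "norm (y x) \<le> sqrt (1 - (x \<bullet> e)\<^sup>2)" using x by (simp add: ice_cream_radius_def y_def)
      have "x \<bullet> e \<le> 1" using True t by (smt (verit) divide_le_eq_1_pos)
      then have "\<bar>x \<bullet> e\<bar> \<le> 1" using x by auto
      then have "(x \<bullet> e)\<^sup>2 \<le> 1" by (simp add: abs_square_le_1)
      then have "(norm (y x))\<^sup>2 \<le> 1 - (x \<bullet> e)\<^sup>2"
        using power_mono[OF n, of 2] by simp
      then have "x \<bullet> x \<le> 1" using pyth[of x] by simp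
      then have "norm x \<le> 1" by (simp add: norm_le_square)
      then show ?thesis using sub by auto
    next
      case False
      then have n: "norm (y x) \<le> (t - x \<bullet> e) / w" using x by (simp add: ice_cream_radius_def y_def w_def)
      show ?thesis
      proof (cases "x \<bullet> e = t")
        case True
        then have "y x = 0" using n by simp
        then have "x = t *\<^sub>R e" using True by (simp add: y_def)
        then show ?thesis using sub by simp
      next
        case neq: False
        have lt: "x \<bullet> e < t" using neq x by simp
        have tt: "t - 1 / t > 0" using t by (simp add: field_simps less_1_mult)
        \<comment> \<open>The ray from the apex through \<open>x\<close> meets the plane of height
          \<open>1 / t\<close> at \<open>b\<close>, and
          \<open>x = (1 - s) *\<^sub>R (t *\<^sub>R e) + s *\<^sub>R b\<close>. The cone bound puts
          \<open>b\<close> within the circle of tangency, of radius \<open>w / t\<close>, hence in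
          the ball.\<close>
        define s where "s = (t - x \<bullet> e) / (t - 1 / t)"
        have s: "0 < s" "s \<le> 1" using lt tt False by (auto simp: s_def field_simps)
        define b where "b = (1 / t) *\<^sub>R e + (1 / s) *\<^sub>R y x"
        have ye: "y x \<bullet> e = 0" by (simp add: y_def inner_diff_left ee)
        have "b \<bullet> b = 1 / t\<^sup>2 + (y x \<bullet> y x) / s\<^sup>2"
          by (simp add: b_def inner_add_left inner_add_right ee ye inner_commute[of e "y x"] power2_eq_square)
        then have bb: "b \<bullet> b = 1 / t\<^sup>2 + (norm (y x) / s)\<^sup>2"
          by (simp add: power_divide power2_norm_eq_inner)
        have "norm (y x) / s \<le> ((t - x \<bullet> e) / w) / s" using n s by (intro divide_right_mono) auto
        also have "\<dots> = (t - 1 / t) / w" using s lt tt by (simp add: s_def)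
        also have "t - 1 / t = w\<^sup>2 / t" unfolding w(2) using t by (simp add: field_simps power2_eq_square)
        also have "w\<^sup>2 / t / w = w / t" using w(1) by (simp add: power2_eq_square)
        finally have "(norm (y x) / s)\<^sup>2 \<le> (w / t)\<^sup>2" using s by (intro power_mono) auto
        also have "(w / t)\<^sup>2 = 1 - 1 / t\<^sup>2" using w t by (simp add: power_divide diff_divide_distrib)
        finally have "b \<bullet> b \<le> 1" using bb by simp
        then have "norm b \<le> 1" by (simp add: norm_le_square)
        then have "b \<in> ?L" using sub by auto
        then have "(1 - s) *\<^sub>R (t *\<^sub>R e) + s *\<^sub>R b \<in> ?L"
          using sub s convexD_alt[OF convex_convex_hull] by (metis less_eq_real_def)
        also have "(1 - s) *\<^sub>R (t *\<^sub>R e) + s *\<^sub>R b = ((1 - s) * t + s / t) *\<^sub>R e + y x"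
          using s by (simp add: b_def algebra_simps)
        also have "(1 - s) * t + s / t = t - s * (t - 1 / t)" by (simp add: algebra_simps)
        also have "\<dots> = x \<bullet> e" using tt by (simp add: s_def)
        also have "(x \<bullet> e) *\<^sub>R e + y x = x" by (simp add: y_def)
        finally show ?thesis .
      qed
    qed
  qed
qed

text \<open>The ratio of the unit ball volumes in dimensions \<open>d - 1\<close> and
  \<open>d\<close>.\<close>

definition g_coeff :: "nat \<Rightarrow> real" where
  "g_coeff d = Gamma (real d / 2 + 1) / (sqrt pi * Gamma ((real d + 1) / 2))"

lemma g_coeff_pos: "g_coeff d > 0"
  unfolding g_coeff_def by (intro divide_pos_pos mult_pos_pos Gamma_real_pos) (auto simp: add_pos_nonneg)

lemma unit_ball_vol_diff_1:
  assumes "d > 0"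
  shows "unit_ball_vol (real (d - 1)) = g_coeff d * unit_ball_vol (real d)"
proof -
  obtain m where d: "d = Suc m" using assms by (cases d) auto
  have G: "Gamma (real d / 2 + 1) \<noteq> 0" "Gamma ((real d + 1) / 2) \<noteq> 0"
    by (intro less_imp_neq[symmetric] Gamma_real_pos; simp add: add_nonneg_pos)+
  have "pi powr (real d / 2) = pi powr (real m / 2) * pi powr (1 / 2)"
    by (simp add: d powr_add[symmetric] add_divide_distrib add.commute)
  then have 1: "pi powr (real d / 2) = pi powr (real m / 2) * sqrt pi"
    by (simp add: powr_half_sqrt)
  have "real m / 2 + 1 = (real d + 1) / 2" by (simp add: d field_simps)
  moreover have "unit_ball_vol (real (d - 1)) = pi powr (real m / 2) / Gamma (real m / 2 + 1)"
    by (simp add: unit_ball_vol_def d)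
  ultimately have 2: "unit_ball_vol (real (d - 1)) = pi powr (real m / 2) / Gamma ((real d + 1) / 2)"
    by (simp only:)
  show ?thesis
    using G by (subst 2, subst unit_ball_vol_def, subst 1) (simp add: g_coeff_def)
qed

text \<open>Substitution \<open>h = cos s\<close>. Up to the factor
  \<open>unit_ball_vol (d - 1)\<close> both sides are the volume of the cap of the unit ball above
  height \<open>1 / t\<close>.\<close>

lemma integral_sin_power_arccos:
  assumes t: "t \<ge> 1" and d: "d > 0"
  shows "integral {0..arccos (1 / t)} (\<lambda>s. sin s ^ d) = integral {1 / t..1} (\<lambda>h. sqrt (1 - h\<^sup>2) ^ (d - 1))"
proof -
  define b where "b = arccos (1 / t)"
  have t': "-1 \<le> 1 / t" "1 / t \<le> 1" using t by (auto simp: field_simps)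
  have b: "0 \<le> b" "b \<le> pi" "cos b = 1 / t" unfolding b_def using t' by (auto simp: arccos_lbound arccos_ubound cos_arccos)
  let ?q = "\<lambda>h::real. sqrt (1 - h\<^sup>2) ^ (d - 1)"
  have "((\<lambda>x. (- sin x) *\<^sub>R ?q (cos x)) has_integral (integral {cos 0..cos b} ?q - integral {cos b..cos 0} ?q)) {0..b}"
    by (rule has_integral_substitution_general[where s = "{}" and c = "-1" and d = 1])
      (use b in \<open>auto intro!: continuous_intros derivative_eq_intros\<close>)
  \<comment> \<open>\<open>cos\<close> decreases, so this interval is empty or a single
    point.\<close>
  also have "integral {cos 0..cos b} ?q = 0" using t' b by (cases "cos b = 1") auto
  finally have "((\<lambda>x. (- sin x) *\<^sub>R ?q (cos x)) has_integral - integral {1 / t..1} ?q) {0..b}"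
    using b by simp
  from has_integral_neg[OF this] have "((\<lambda>x. sin x * ?q (cos x)) has_integral integral {1 / t..1} ?q) {0..b}"
    by simp
  moreover have "sin x * ?q (cos x) = sin x ^ d" if "x \<in> {0..b}" for x
  proof -
    have "sin x \<ge> 0" using that b by (intro sin_ge_zero) auto
    then have "sqrt (1 - (cos x)\<^sup>2) = sin x" by (simp add: sin_squared_eq[symmetric])
    then show ?thesis using d by (simp add: power_eq_if)
  qed
  ultimately have "((\<lambda>x. sin x ^ d) has_integral integral {1 / t..1} ?q) {0..b}"
    using has_integral_cong by (metis (no_types, lifting))
  then show ?thesis unfolding b_def by (simp add: integral_unique)
qed

lemma powr_minus_2: "t > 0 \<Longrightarrow> t powr (-2) = 1 / (t::real)\<^sup>2"
  by (simp add: powr_minus powr_numeral field_simps)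

text \<open>In the hull the tangent cone replaces the cap of the ball above height
  \<open>1 / t\<close>: ball plus cone minus cap, in units of the ball, are the terms of
  \<open>g_fun\<close>. A basis direction suffices because whitening moves the direction at hand to
  an axis.\<close>

lemma emeasure_convex_hull_cball_insert:
  fixes e :: "'a::euclidean_space"
  assumes e: "e \<in> Basis" and t: "t \<ge> 1"
  shows "emeasure lborel (convex hull (cball 0 1 \<union> {t *\<^sub>R e}))
       = ennreal (unit_ball_vol DIM('a) * g_fun DIM('a) t)"
proof -
  define d where "d = DIM('a)"
  have d: "d > 0" by (simp add: d_def)
  define q where "q h = sqrt (1 - h\<^sup>2) ^ (d - 1)" for h :: real
  have qc: "continuous_on X q" for X unfolding q_def by (intro continuous_intros)
  then have qi: "q integrable_on {a..b}" for a b by (intro integrable_continuous_real)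
  have ne: "norm e = 1" using e by simp
  have g: "g_fun d s = 1 + g_coeff d * (s / d * (1 - 1 / s\<^sup>2) powr ((real d + 1) / 2) - integral {1 / s..1} q)"
    if "s \<ge> 1" for s
    using that d by (simp add: g_fun_def g_coeff_def integral_sin_power_arccos powr_minus_2 q_def[abs_def])
  have cball: "cball (0::'a) 1 = {x. x \<bullet> e \<in> {-1..1} \<and> norm (x - (x \<bullet> e) *\<^sub>R e) \<le> sqrt (1 - (x \<bullet> e)\<^sup>2)}"
  proof -
    have "(norm (x - (x \<bullet> e) *\<^sub>R e))\<^sup>2 = x \<bullet> x - (x \<bullet> e)\<^sup>2" for x
      unfolding power2_norm_eq_inner using ne
      by (simp add: inner_diff_left inner_diff_right inner_commute power2_eq_square norm_eq_1)
    then have 1: "norm (x - (x \<bullet> e) *\<^sub>R e) \<le> sqrt (1 - (x \<bullet> e)\<^sup>2) \<longleftrightarrow> x \<bullet> x \<le> 1" if "(x \<bullet> e)\<^sup>2 \<le> 1" for x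
      using that by (subst norm_le_square) (auto simp flip: power2_norm_eq_inner)
    have 2: "\<bar>x \<bullet> e\<bar> \<le> 1" if "x \<bullet> x \<le> 1" for x
    proof -
      have "norm x \<le> 1" using that by (simp add: norm_le_square)
      then show ?thesis using Cauchy_Schwarz_ineq2[of x e] ne by simp
    qed
    show ?thesis
    proof (intro set_eqI)
      fix x :: 'a
      have "x \<in> cball 0 1 \<longleftrightarrow> x \<bullet> x \<le> 1" by (simp add: norm_le_square)
      moreover have "x \<bullet> e \<in> {-1..1} \<longleftrightarrow> \<bar>x \<bullet> e\<bar> \<le> 1" by auto
      moreover have "\<bar>x \<bullet> e\<bar> \<le> 1 \<longleftrightarrow> (x \<bullet> e)\<^sup>2 \<le> 1" by (simp add: abs_square_le_1)
      ultimately show "x \<in> cball 0 1 \<longleftrightarrow> x \<in> {x. x \<bullet> e \<in> {-1..1} \<and> norm (x - (x \<bullet> e) *\<^sub>R e) \<le> sqrt (1 - (x \<bullet> e)\<^sup>2)}"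
        using 1 2 by blast
    qed
  qed
  have lt1: "1 - h\<^sup>2 > 0" if "-1 < h" "h < 1" for h :: real
    using that by (simp add: abs_square_less_1[THEN iffD2] abs_less_iff)
  \<comment> \<open>Slicing the ball itself identifies the full integral of \<open>q\<close> without
    evaluating it.\<close>
  have q1: "unit_ball_vol (d - 1) * integral {-1..1} q = unit_ball_vol d"
  proof -
    have "emeasure lborel (cball (0::'a) 1) = ennreal (unit_ball_vol (d - 1) * integral {-1..1} q)"
      unfolding cball d_def
      by (rule emeasure_solid_of_revolution[OF e])
        (use lt1 integrable_integral[OF qi[of "-1" 1]] in \<open>auto simp: q_def[abs_def] d_def\<close>)
    moreover have "integral {-1..1} q \<ge> 0"
      by (rule integral_nonneg) (auto simp: qi q_def abs_square_le_1 abs_le_iff)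
    ultimately show ?thesis by (simp add: emeasure_cball d_def ennreal_inj)
  qed
  show ?thesis
  \<comment> \<open>At \<open>t = 1\<close> the cone degenerates and \<open>w\<close> below would
    vanish.\<close>
  proof (cases "t = 1")
    case True
    have "e \<in> cball 0 1" using ne by simp
    then have "convex hull (cball 0 1 \<union> {t *\<^sub>R e}) = cball 0 1"
      using True by (simp add: insert_absorb convex_hull_eq)
    moreover have "g_fun d 1 = 1" by (simp add: g)
    ultimately show ?thesis using True by (simp add: emeasure_cball d_def)
  next
    case False
    then have t1: "t > 1" using t by simp
    define w where "w = sqrt (t\<^sup>2 - 1)"
    have w: "w > 0" "w\<^sup>2 = t\<^sup>2 - 1" using t1 by (auto simp: w_def one_less_power)
    have ord: "-1 \<le> 1 / t" "1 / t \<le> t" "1 / t < 1"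
      using t1 by (auto simp: field_simps) (smt (verit) mult_less_cancel_right1)
    \<comment> \<open>\<open>J\<close> is the volume of the tangent cone divided by
      \<open>unit_ball_vol (d - 1)\<close>: base radius \<open>w / t\<close>, height
      \<open>t - 1 / t = w * (w / t)\<close>.\<close>
    define J where "J = t / d * (1 - 1 / t\<^sup>2) powr ((real d + 1) / 2)"
    let ?r = "\<lambda>h. ice_cream_radius t h ^ (d - 1)"
    have i1: "(?r has_integral integral {-1..1 / t} q) {-1..1 / t}"
      using integrable_integral[OF qi] by (rule has_integral_eq[rotated]) (auto simp: ice_cream_radius_def q_def)
    have i2: "(?r has_integral J) {1 / t..t}"
    proof -
      have "((\<lambda>h. ((t - h) / w) ^ (d - 1)) has_integral (- ((t - t) ^ d / (d * w ^ (d - 1)))) - (- ((t - 1 / t) ^ d / (d * w ^ (d - 1))))) {1 / t..t}"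
      proof (rule fundamental_theorem_of_calculus[OF ord(2)])
        fix h assume "h \<in> {1 / t..t}"
        show "((\<lambda>h. - ((t - h) ^ d / (d * w ^ (d - 1)))) has_vector_derivative ((t - h) / w) ^ (d - 1)) (at h within {1 / t..t})"
          unfolding has_real_derivative_iff_has_vector_derivative[symmetric]
          using d w by (auto intro!: derivative_eq_intros simp: power_divide)
      qed
      also have "(- ((t - t) ^ d / (d * w ^ (d - 1)))) - (- ((t - 1 / t) ^ d / (d * w ^ (d - 1)))) = (t - 1 / t) ^ d / (d * w ^ (d - 1))"
        using d by simp
      also have "\<dots> = J"
      proof -
        obtain m where m: "d = Suc m" using d by (cases d) auto
        have wt: "1 - 1 / t\<^sup>2 = (w / t)\<^sup>2" using w t1 by (simp add: power_divide diff_divide_distrib)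
        have "(1 - 1 / t\<^sup>2) powr ((real d + 1) / 2) = (w / t) powr (2 * ((real d + 1) / 2))"
          unfolding wt using w t1 by (subst powr_powr[symmetric]) (simp add: powr_numeral)
        also have "2 * ((real d + 1) / 2) = real (d + 1)" by simp
        also have "(w / t) powr real (d + 1) = (w / t) ^ (d + 1)" using w t1 by (intro powr_realpow) simp
        finally have J: "J = t / d * (w / t) ^ (d + 1)" by (simp add: J_def)
        have tw: "t - 1 / t = w * (w / t)" using w t1 by (simp add: field_simps power2_eq_square)
        have "(t - 1 / t) ^ d / (d * w ^ (d - 1)) = w ^ d * (w / t) ^ d / (d * w ^ (d - 1))"
          unfolding tw power_mult_distrib ..
        also have "\<dots> = w * (w / t) ^ d / d" using w by (simp add: m)
        also have "\<dots> = J" using t1 by (simp add: J)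
        finally show ?thesis .
      qed
      finally have "((\<lambda>h. ((t - h) / w) ^ (d - 1)) has_integral J) {1 / t..t}" .
      moreover have "?r h = ((t - h) / w) ^ (d - 1)" if "h \<in> {1 / t..t}" for h
      \<comment> \<open>At the seam the definition takes the ball branch; by tangency both branches
        agree there.\<close>
      proof (cases "h = 1 / t")
        case True
        have "sqrt (1 - h\<^sup>2) = w / t"
          using w t1 by (intro real_sqrt_unique) (auto simp: True power_divide diff_divide_distrib)
        also have "\<dots> = (t - h) / w" using w t1 by (simp add: True field_simps power2_eq_square)
        finally show ?thesis by (simp add: ice_cream_radius_def True)
      next
        case False
        then show ?thesis using that by (simp add: ice_cream_radius_def w_def)
      qed
      ultimately show ?thesis using has_integral_cong by (metis (no_types, lifting))
    qed
    have int: "(?r has_integral integral {-1..1 / t} q + J) {-1..t}"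
      using has_integral_combine[OF ord(1,2) i1 i2] .
    have "emeasure lborel (convex hull (cball 0 1 \<union> {t *\<^sub>R e}))
       = ennreal (unit_ball_vol (d - 1) * (integral {-1..1 / t} q + J))"
      unfolding convex_hull_cball_insert_eq[OF ne t1] d_def
    proof (rule emeasure_solid_of_revolution[OF e])
      show "ice_cream_radius t \<in> borel_measurable borel" unfolding ice_cream_radius_def by measurable
      fix h assume "-1 < h" "h < t"
      then show "0 < ice_cream_radius t h" using ord w lt1[of h] by (auto simp: ice_cream_radius_def w_def)
    qed (use int in \<open>simp add: d_def\<close>)
    also have "unit_ball_vol (d - 1) * (integral {-1..1 / t} q + J)
       = unit_ball_vol (d - 1) * integral {-1..1} q + unit_ball_vol (d - 1) * (J - integral {1 / t..1} q)"
    proof -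
      have "integral {-1..1} q = integral {-1..1 / t} q + integral {1 / t..1} q"
        using Henstock_Kurzweil_Integration.integral_combine[of "-1" "1 / t" 1 q] qi ord by simp
      then show ?thesis by (simp only:) (simp add: algebra_simps)
    qed
    also have "\<dots> = unit_ball_vol d + g_coeff d * unit_ball_vol d * (J - integral {1 / t..1} q)"
      using q1 unit_ball_vol_diff_1[OF d] by simp
    also have "\<dots> = unit_ball_vol d * g_fun d t"
    proof -
      have "g_fun d t = 1 + g_coeff d * (J - integral {1 / t..1} q)" using g[OF t] by (simp only: J_def)
      then show ?thesis by (simp only:) (simp add: algebra_simps)
    qed
    finally show ?thesis by (simp add: d_def)
  qed
qed

section \<open>Continuity and strict monotonicity of g_d\<close>

lemma g_fun_1: "g_fun d 1 = 1"
  by (simp add: g_fun_def)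

lemma continuous_on_g_fun:
  assumes "d > 0" shows "continuous_on {1..} (g_fun d)"
proof -
  have "continuous_on {1..} (\<lambda>t. integral {0..arccos (1 / t)} (\<lambda>s::real. sin s ^ d))"
  proof (rule continuous_on_compose2[of "{0..pi}" "\<lambda>x. integral {0..x} (\<lambda>s::real. sin s ^ d)"])
    show "continuous_on {0..pi} (\<lambda>x. integral {0..x} (\<lambda>s. sin s ^ d))"
      by (intro indefinite_integral_continuous_1 integrable_continuous_real continuous_intros)
    have *: "-1 \<le> 1 / t" "1 / t \<le> 1" if "t \<ge> 1" for t :: real using that by (auto simp: field_simps)
    show "continuous_on {1..} (\<lambda>t::real. arccos (1 / t))"
      by (intro continuous_intros) (use * in auto)
    show "(\<lambda>t::real. arccos (1 / t)) ` {1..} \<subseteq> {0..pi}"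
    proof (rule image_subsetI)
      fix t :: real assume "t \<in> {1..}"
      then show "arccos (1 / t) \<in> {0..pi}" using *[of t] by (simp add: arccos_lbound arccos_ubound)
    qed
  qed
  moreover have "continuous_on {1..} (\<lambda>t::real. (1 - t powr (-2)) powr ((real d + 1) / 2))"
  proof (rule continuous_on_powr')
    show "\<forall>t\<in>{1::real..}. 1 - t powr (-2) \<ge> 0 \<and> (1 - t powr (-2) = 0 \<longrightarrow> (real d + 1) / 2 > 0)"
      by (auto simp: powr_minus_2 one_le_power)
  qed (auto intro!: continuous_intros)
  ultimately show ?thesis
    using assms unfolding g_fun_def[abs_def] g_coeff_def[symmetric]
    by (intro continuous_on_add continuous_on_mult continuous_on_diff continuous_on_const
      continuous_on_divide continuous_on_id) auto
qed

text \<open>With \<open>v = 1 - 1 / t\<^sup>2\<close> all contributions share the factor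
  \<open>v powr ((real d - 1) / 2)\<close>, and what remains collapses:
  \<open>v / d + (d + 1) / (d * t\<^sup>2) - 1 / t\<^sup>2 = 1 / d\<close>.\<close>

lemma g_fun_has_derivative:
  assumes t: "t > 1" and d: "d > 0"
  shows "(g_fun d has_real_derivative g_coeff d / d * (1 - 1 / t\<^sup>2) powr ((real d - 1) / 2)) (at t)"
proof -
  define v where "v = 1 - 1 / t\<^sup>2"
  have v: "v > 0" using t by (simp add: v_def one_less_power)
  have it: "-1 < 1 / t" "1 / t < 1" using t by (auto simp: field_simps)
  have ac: "0 < arccos (1 / t)" "arccos (1 / t) < pi" using arccos_lt_bounded[OF it] by auto
  have D1: "((\<lambda>x. integral {0..x} (\<lambda>s. sin s ^ d)) has_real_derivative sin (arccos (1 / t)) ^ d) (at (arccos (1 / t)))"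
    using integral_has_real_derivative[of 0 pi "\<lambda>s. sin s ^ d" "arccos (1 / t)"] ac
      continuous_on_power[OF continuous_on_sin[OF continuous_on_id], of "{0..pi}" d]
    by (simp add: at_within_Icc_at)
  have D2: "((\<lambda>t. arccos (1 / t)) has_real_derivative 1 / (t\<^sup>2 * sqrt v)) (at t)"
    using it t by (auto intro!: derivative_eq_intros simp: v_def power_divide field_simps power2_eq_square)
  have D3: "((\<lambda>t. integral {0..arccos (1 / t)} (\<lambda>s. sin s ^ d)) has_real_derivative v powr ((real d - 1) / 2) / t\<^sup>2) (at t)"
  proof -
    have "sin (arccos (1 / t)) = sqrt v" using it by (simp add: sin_arccos v_def power_divide)
    also have "\<dots> = v powr (1 / 2)" using v by (simp add: powr_half_sqrt)
    finally have "sin (arccos (1 / t)) ^ d = (v powr (1 / 2)) ^ d" by simp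
    also have "\<dots> = v powr (real d / 2)" using v by (simp add: powr_realpow[symmetric] powr_powr)
    also have "\<dots> = v powr ((real d - 1) / 2) * sqrt v"
      using v by (simp add: powr_half_sqrt[symmetric] powr_add[symmetric] diff_divide_distrib)
    finally show ?thesis using DERIV_chain2[OF D1 D2] v by simp
  qed
  have D4: "((\<lambda>t. t / d * (1 - t powr (-2)) powr ((real d + 1) / 2)) has_real_derivative
     1 / d * v powr ((real d + 1) / 2) + t / d * ((real d + 1) / 2 * v powr ((real d - 1) / 2) * (2 / t ^ 3))) (at t)"
  proof -
    have "((\<lambda>t. (1 - t powr (-2))) has_real_derivative 2 / t ^ 3) (at t)"
      using t by (auto intro!: derivative_eq_intros simp: powr_minus powr_numeral field_simps eval_nat_numeral)
    then have "((\<lambda>t. (1 - t powr (-2)) powr ((real d + 1) / 2)) has_real_derivative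
        (real d + 1) / 2 * v powr ((real d - 1) / 2) * (2 / t ^ 3)) (at t)"
      using DERIV_fun_powr[of "\<lambda>t. 1 - t powr (-2)" "2 / t ^ 3" t "(real d + 1) / 2"] t v powr_minus_2[of t]
      by (simp add: v_def add_divide_distrib diff_divide_distrib)
    from DERIV_mult'[OF DERIV_cdivide[OF DERIV_ident, of "real d"] this] show ?thesis
      using t powr_minus_2[of t] by (simp add: v_def algebra_simps)
  qed
  have "(g_fun d has_real_derivative g_coeff d *
     (1 / d * v powr ((real d + 1) / 2) + t / d * ((real d + 1) / 2 * v powr ((real d - 1) / 2) * (2 / t ^ 3))
      - v powr ((real d - 1) / 2) / t\<^sup>2)) (at t)"
    unfolding g_fun_def[abs_def] g_coeff_def[symmetric]
    using DERIV_add[OF DERIV_const[of 1] DERIV_cmult[OF DERIV_diff[OF D4 D3], of "g_coeff d"]] by simp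
  also have "v powr ((real d + 1) / 2) = v powr ((real d - 1) / 2) * v"
  proof -
    have "v powr ((real d - 1) / 2) * v = v powr ((real d - 1) / 2) * v powr 1" using v by simp
    also have "\<dots> = v powr ((real d + 1) / 2)" unfolding powr_add[symmetric] by (simp add: field_simps)
    finally show ?thesis ..
  qed
  also have "g_coeff d * (1 / d * (v powr ((real d - 1) / 2) * v) + t / d * ((real d + 1) / 2 * v powr ((real d - 1) / 2) * (2 / t ^ 3))
      - v powr ((real d - 1) / 2) / t\<^sup>2)
      = g_coeff d / d * v powr ((real d - 1) / 2) * (v + 1 / t\<^sup>2)"
    using t d by (simp add: field_simps power2_eq_square power3_eq_cube)
  also have "v + 1 / t\<^sup>2 = 1" by (simp add: v_def)
  finally show ?thesis by (simp add: v_def)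
qed

text \<open>The derivative is available only beyond 1, so the open interval is combined with
  continuity at the end point.\<close>

lemma g_fun_strict_mono:
  assumes "1 \<le> s" "s < t" "d > 0"
  shows "g_fun d s < g_fun d t"
proof (rule DERIV_pos_imp_increasing_open[OF assms(2)])
  fix x assume "s < x" "x < t"
  then have x: "x > 1" using assms by simp
  then have "x\<^sup>2 > 1" by (simp add: one_less_power)
  then have "g_coeff d / d * (1 - 1 / x\<^sup>2) powr ((real d - 1) / 2) > 0"
    using assms g_coeff_pos[of d] by (intro mult_pos_pos divide_pos_pos) auto
  then show "\<exists>y. (g_fun d has_real_derivative y) (at x) \<and> 0 < y"
    using g_fun_has_derivative[OF x assms(3)] by blast
next
  show "continuous_on {s..t} (g_fun d)"
    using assms by (intro continuous_on_subset[OF continuous_on_g_fun]) auto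
qed

lemma g_fun_mono: "1 \<le> s \<Longrightarrow> s \<le> t \<Longrightarrow> d > 0 \<Longrightarrow> g_fun d s \<le> g_fun d t"
  using g_fun_strict_mono[of s t d] by (cases "s = t") auto

subsection \<open>The standard normal distribution function\<close>

text \<open>Serves to evaluate \<open>Phi_inv\<close> and \<open>g_inv\<close> at perturbed values:
  the preimage and its error bound come together, uniformly on \<open>{a..b}\<close>. The increments
  collected in \<open>h\<close> have a positive minimum there, and the intermediate value theorem
  does the rest.\<close>

lemma strict_mono_locally_onto:
  fixes f :: "real \<Rightarrow> real"
  assumes mono: "strict_mono f" and cont: "continuous_on UNIV f" and "\<epsilon> > 0"
  obtains \<kappa> where "\<kappa> > 0"
    "\<And>t s. t \<in> {a..b} \<Longrightarrow> \<bar>s - f t\<bar> < \<kappa> \<Longrightarrow> \<exists>t'. f t' = s \<and> \<bar>t' - t\<bar> \<le> \<epsilon>"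
proof (cases "a \<le> b")
  case True
  have [continuous_intros]: "continuous_on X (\<lambda>x. f (g x))" if "continuous_on X g" for g :: "real \<Rightarrow> real" and X
    using continuous_on_compose2[OF cont that] by simp
  define h where "h t = min (f (t + \<epsilon>) - f t) (f t - f (t - \<epsilon>))" for t
  have "continuous_on {a..b} h" unfolding h_def by (intro continuous_intros)
  then obtain t0 where t0: "t0 \<in> {a..b}" "\<And>t. t \<in> {a..b} \<Longrightarrow> h t0 \<le> h t"
    using continuous_attains_inf[of "{a..b}" h] True by auto
  have "h t0 > 0" using mono \<open>\<epsilon> > 0\<close> by (simp add: h_def strict_mono_def)
  then show ?thesis
  proof (rule that)
    fix t s assume t: "t \<in> {a..b}" and s: "\<bar>s - f t\<bar> < h t0"
    have "f (t - \<epsilon>) \<le> s" "s \<le> f (t + \<epsilon>)" using t0(2)[OF t] s by (auto simp: h_def)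
    then obtain t' where "t - \<epsilon> \<le> t'" "t' \<le> t + \<epsilon>" "f t' = s"
      using IVT'[of f "t - \<epsilon>" s "t + \<epsilon>"] \<open>\<epsilon> > 0\<close> continuous_on_subset[OF cont] by auto
    then show "\<exists>t'. f t' = s \<and> \<bar>t' - t\<bar> \<le> \<epsilon>" by (intro exI[of _ t']) auto
  qed
qed (use that[of 1] in auto)

lemma Phi_eq_measure: "Phi t = measure std_normal_distribution {..t}"
proof -
  have "emeasure std_normal_distribution {..t} = (\<integral>\<^sup>+x. ennreal (std_normal_density x * indicator {..t} x) \<partial>lborel)"
    by (subst emeasure_density) (auto simp: ennreal_mult' ennreal_indicator intro!: nn_integral_cong)
  also have "\<dots> = ennreal (LINT x|lborel. std_normal_density x * indicator {..t} x)"
    by (intro nn_integral_eq_integral integrable_real_mult_indicator) (auto intro: integrable_normal_density)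
  finally show ?thesis
    by (simp add: Phi_def measure_def set_lebesgue_integral_def mult.commute Bochner_Integration.integral_nonneg)
qed

interpretation std_normal: real_distribution std_normal_distribution
  by (rule real_dist_normal_dist)

lemma Phi_diff:
  assumes "s \<le> t"
  shows "Phi t - Phi s = (LINT x|lborel. std_normal_density x * indicator {s<..t} x)"
proof -
  have i: "integrable lborel (\<lambda>x. std_normal_density x * indicator A x)" if "A \<in> sets borel" for A
    using that by (intro integrable_real_mult_indicator) (auto intro: integrable_normal_density)
  have "Phi t - Phi s = (LINT x|lborel. std_normal_density x * indicator {..t} x - std_normal_density x * indicator {..s} x)"
    unfolding Phi_def set_lebesgue_integral_def
    by (subst Bochner_Integration.integral_diff) (auto simp: i mult.commute)
  also have "\<dots> = (LINT x|lborel. std_normal_density x * indicator {s<..t} x)"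
    using assms by (intro Bochner_Integration.integral_cong) (auto simp: indicator_def)
  finally show ?thesis .
qed

text \<open>The density is at most 1. This Lipschitz bound gives continuity of \<open>Phi\<close>
  and later controls the mass of thin slabs.\<close>

lemma Phi_diff_le:
  assumes "s \<le> t" shows "Phi t - Phi s \<le> t - s"
proof -
  have i: "integrable lborel (\<lambda>x. std_normal_density x * indicator A x)" if "A \<in> sets borel" for A
    using that by (intro integrable_real_mult_indicator) (auto intro: integrable_normal_density)
  have "1 \<le> sqrt (2 * pi)" using pi_ge_two by (intro real_le_rsqrt) simp
  then have "1 / sqrt (2 * pi) * exp (- x\<^sup>2 / 2) \<le> 1 * 1" for x :: real
    by (intro mult_mono) auto
  then have "std_normal_density x \<le> 1" for x by (simp add: std_normal_density_def)
  then have "(LINT x|lborel. std_normal_density x * indicator {s<..t} x) \<le> (LINT x|lborel. indicator {s<..t} x)"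
    using assms by (intro integral_mono i integrable_real_indicator) (auto simp: indicator_def)
  then show ?thesis using assms Phi_diff[OF assms] by simp
qed

lemma strict_mono_Phi: "strict_mono Phi"
proof (rule strict_monoI)
  fix s t :: real assume "s < t"
  have "(\<integral>\<^sup>+x. ennreal (std_normal_density x * indicator {s<..t} x) \<partial>lborel) \<noteq> 0"
  proof
    assume "(\<integral>\<^sup>+x. ennreal (std_normal_density x * indicator {s<..t} x) \<partial>lborel) = 0"
    then have ae: "AE x in lborel. std_normal_density x * indicator {s<..t} x \<le> 0"
      by (subst (asm) nn_integral_0_iff_AE) (auto simp: ennreal_eq_0_iff)
    have "std_normal_density x > 0" for x by (rule normal_density_pos) simp
    then have "x \<notin> {s<..t}" if "std_normal_density x * indicator {s<..t} x \<le> 0" for x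
      using that by (metis indicator_simps(1) mult.right_neutral not_le)
    with ae have "AE x in lborel. x \<notin> {s<..t}" by (rule eventually_mono)
    then have "emeasure lborel {s<..t} = 0"
      using emeasure_eq_0_AE[of "\<lambda>x. x \<in> {s<..t}" lborel]
      by (simp add: greaterThanAtMost_def greaterThan_def atMost_def Collect_conj_eq)
    then show False using \<open>s < t\<close> by simp
  qed
  moreover have "(\<integral>\<^sup>+x. ennreal (std_normal_density x * indicator {s<..t} x) \<partial>lborel) = ennreal (Phi t - Phi s)"
    unfolding Phi_diff[OF less_imp_le[OF \<open>s < t\<close>]]
    by (intro nn_integral_eq_integral integrable_real_mult_indicator) (auto intro: integrable_normal_density)
  ultimately show "Phi s < Phi t" by (simp add: ennreal_eq_0_iff not_le)
qed

lemma Phi_less_iff [simp]: "Phi s < Phi t \<longleftrightarrow> s < t"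
  and Phi_le_iff [simp]: "Phi s \<le> Phi t \<longleftrightarrow> s \<le> t"
  and Phi_eq_iff [simp]: "Phi s = Phi t \<longleftrightarrow> s = t"
  using strict_mono_Phi by (simp_all add: strict_mono_less strict_mono_less_eq strict_mono_eq)

lemma continuous_on_Phi: "continuous_on X Phi"
proof -
  have "1-lipschitz_on UNIV Phi"
  proof (rule lipschitz_onI)
    fix x y :: real
    show "dist (Phi x) (Phi y) \<le> 1 * dist x y"
      using Phi_diff_le[of x y] Phi_diff_le[of y x] Phi_le_iff[of x y] Phi_le_iff[of y x]
      by (auto simp: dist_real_def abs_if)
  qed simp
  then show ?thesis using lipschitz_on_continuous_on continuous_on_subset by blast
qed

lemma Phi_uminus: "Phi (- t) = 1 - Phi t"
proof -
  have "1 - Phi t = measure std_normal_distribution (UNIV - {..t})"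
    using std_normal.prob_compl[of "{..t}"] by (simp add: Phi_eq_measure)
  also have "UNIV - {..t} = {t<..}" by auto
  finally have 1: "1 - Phi t = measure std_normal_distribution {t<..}" .
  have "emeasure std_normal_distribution {t<..} = (\<integral>\<^sup>+x. ennreal (std_normal_density x) * indicator {t<..} x \<partial>lborel)"
    by (rule emeasure_density) auto
  also have "\<dots> = (\<integral>\<^sup>+x. ennreal (std_normal_density x) * indicator {..<- t} x \<partial>lborel)"
    by (subst nn_integral_real_affine[of _ "-1" 0])
      (auto simp: indicator_def std_normal_density_def intro!: nn_integral_cong)
  \<comment> \<open>Reflection produced the open ray; its end point is a null set.\<close>
  also have "\<dots> = (\<integral>\<^sup>+x. ennreal (std_normal_density x) * indicator {..- t} x \<partial>lborel)"
  proof (intro nn_integral_cong_AE)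
    have "AE h in lborel. h \<notin> {- t}"
      by (intro AE_not_in countable_imp_null_set_lborel) auto
    then show "AE x in lborel. ennreal (std_normal_density x) * indicator {..<- t} x = ennreal (std_normal_density x) * indicator {..- t} x"
      by eventually_elim (auto simp: indicator_def)
  qed
  also have "\<dots> = emeasure std_normal_distribution {..- t}"
    by (rule emeasure_density[symmetric]) auto
  finally show ?thesis using 1 by (simp add: Phi_eq_measure measure_def)
qed

lemma Phi_pos: "Phi t > 0" and Phi_less_1: "Phi t < 1"
proof -
  have "Phi (t - 1) \<ge> 0" for t by (simp add: Phi_eq_measure)
  then show pos: "Phi t > 0" for t using Phi_less_iff[of "t - 1" t] by (meson le_less_trans less_add_one less_diff_eq diff_less_eq order_less_le_trans)
  show "Phi t < 1" using pos[of "- t"] by (simp add: Phi_uminus)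
qed

lemma Phi_onto:
  assumes "0 < p" "p < 1" obtains t where "Phi t = p"
proof -
  have eq: "Phi = cdf std_normal_distribution" by (auto simp: cdf_def Phi_eq_measure)
  have "(Phi \<longlongrightarrow> 0) at_bot" "(Phi \<longlongrightarrow> 1) at_top"
    unfolding eq using std_normal.cdf_lim_at_bot std_normal.cdf_lim_at_top_prob by auto
  then have "\<forall>\<^sub>F x in at_bot. Phi x < p" "\<forall>\<^sub>F x in at_top. Phi x > p"
    using assms by (auto intro: order_tendstoD)
  then obtain a b where ab: "Phi a < p" "p < Phi b"
    by (meson eventually_happens' trivial_limit_at_bot_linorder trivial_limit_at_top_linorder)
  then have "a < b" using Phi_less_iff[of a b] by linarith
  then show ?thesis using IVT'[of Phi a p b] ab continuous_on_Phi that by auto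
qed

lemma Phi_inv_eqI: "Phi t = p \<Longrightarrow> Phi_inv p = t"
  unfolding Phi_inv_def by (rule the_equality) auto

lemma upper_normal_quantile:
  assumes "0 < \<delta>" "\<delta> < 1/2"
  obtains r where "r > 0" "Phi (- r) = \<delta>" "Phi_inv (1 - \<delta>) = r"
proof -
  obtain t where t: "Phi t = \<delta>" using Phi_onto[of \<delta>] assms by auto
  have "Phi 0 = 1 / 2" using Phi_uminus[of 0] by simp
  then have "t < 0" using assms t Phi_less_iff[of t 0] by simp
  moreover have "Phi_inv (1 - \<delta>) = - t" by (rule Phi_inv_eqI) (simp add: Phi_uminus t)
  ultimately show ?thesis using that[of "- t"] t by simp
qed

subsection \<open>Halfspace depth and depth regions of a Gaussian\<close>

lemma continuous_on_mahal: "continuous_on X (\<lambda>x. mahal S x mu)"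
  unfolding mahal_def
  by (intro continuous_intros bounded_linear.continuous_on[OF matrix_vector_mul_bounded_linear])

lemma borel_measurable_gauss_density [measurable]: "gauss_density mu S \<in> borel_measurable borel"
proof -
  have [measurable]: "(\<lambda>x. mahal S x mu) \<in> borel_measurable borel"
    by (intro borel_measurable_continuous_onI continuous_on_mahal)
  show ?thesis unfolding gauss_density_def[abs_def] by measurable
qed

text \<open>The integral factors over the coordinates, and every factor except that of
  \<open>e\<close> is a total mass one.\<close>

lemma nn_integral_std_normal_prod:
  fixes e :: "'a::euclidean_space"
  assumes "e \<in> Basis"
  shows "(\<integral>\<^sup>+z. ennreal ((\<Prod>b\<in>Basis. std_normal_density (z \<bullet> b)) * indicator {..a} (z \<bullet> e)) \<partial>(lborel :: 'a measure)) = ennreal (Phi a)"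
proof -
  let ?f = "\<lambda>b x. std_normal_density x * (if b = e then indicator {..a} x else 1)"
  have "(\<integral>\<^sup>+z. ennreal ((\<Prod>b\<in>Basis. std_normal_density (z \<bullet> b)) * indicator {..a} (z \<bullet> e)) \<partial>(lborel :: 'a measure))
      = (\<integral>\<^sup>+z. (\<Prod>b\<in>Basis. ennreal (?f b (z \<bullet> b))) \<partial>(lborel :: 'a measure))"
  proof (intro nn_integral_cong)
    fix z :: 'a
    have "(\<Prod>b\<in>Basis. if b = e then indicator {..a} (z \<bullet> b) else 1) = (indicator {..a} (z \<bullet> e) :: real)"
      using assms by (simp add: prod.delta)
    then show "ennreal ((\<Prod>b\<in>Basis. std_normal_density (z \<bullet> b)) * indicator {..a} (z \<bullet> e)) = (\<Prod>b\<in>Basis. ennreal (?f b (z \<bullet> b)))"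
      by (subst prod_ennreal) (auto simp: prod.distrib)
  qed
  also have "\<dots> = (\<Prod>b\<in>(Basis::'a set). (\<integral>\<^sup>+x. ennreal (?f b x) \<partial>lborel))"
    by (intro nn_integral_lborel_prod) auto
  also have "\<dots> = (\<Prod>b\<in>(Basis::'a set). if b = e then ennreal (Phi a) else 1)"
  proof (rule prod.cong)
    fix b :: 'a
    have "(\<integral>\<^sup>+x. ennreal (std_normal_density x * indicator {..a} x) \<partial>lborel) = emeasure std_normal_distribution {..a}"
      by (subst emeasure_density) (auto simp: ennreal_mult' ennreal_indicator intro!: nn_integral_cong)
    also have "\<dots> = ennreal (Phi a)" by (simp add: Phi_eq_measure std_normal.emeasure_eq_measure)
    finally have 1: "(\<integral>\<^sup>+x. ennreal (std_normal_density x * indicator {..a} x) \<partial>lborel) = ennreal (Phi a)" .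
    have "emeasure std_normal_distribution (space std_normal_distribution) = 1" by (rule std_normal.emeasure_space_1)
    then have "(\<integral>\<^sup>+x. ennreal (std_normal_density x) \<partial>lborel) = 1"
      by (simp add: emeasure_density)
    with 1 show "(\<integral>\<^sup>+x. ennreal (?f b x) \<partial>lborel) = (if b = e then ennreal (Phi a) else 1)"
      by simp
  qed simp
  also have "\<dots> = ennreal (Phi a)" using assms by (simp add: prod.delta)
  finally show ?thesis .
qed

lemma nn_integral_std_normal_prod_UNIV:
  "(\<integral>\<^sup>+z. ennreal (\<Prod>b\<in>Basis. std_normal_density (z \<bullet> b)) \<partial>(lborel :: 'a::euclidean_space measure)) = 1"
proof -
  have 1: "(\<integral>\<^sup>+x. ennreal (std_normal_density x) \<partial>lborel) = 1"
    using std_normal.emeasure_space_1 by (simp add: emeasure_density)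
  have "(\<integral>\<^sup>+z. ennreal (\<Prod>b\<in>Basis. std_normal_density (z \<bullet> b)) \<partial>(lborel :: 'a measure))
     = (\<integral>\<^sup>+z. (\<Prod>b\<in>Basis. ennreal (std_normal_density (z \<bullet> b))) \<partial>(lborel :: 'a measure))"
    by (simp add: prod_ennreal)
  also have "\<dots> = (\<Prod>b\<in>(Basis::'a set). (\<integral>\<^sup>+x. ennreal (std_normal_density x) \<partial>lborel))"
    by (intro nn_integral_lborel_prod) auto
  finally show ?thesis by (simp add: 1)
qed

lemma std_normal_prod_eq:
  "(\<Prod>b\<in>Basis. std_normal_density (z \<bullet> b)) = exp (- (norm z)\<^sup>2 / 2) / sqrt (2 * pi) ^ DIM('a)"
  for z :: "'a::euclidean_space"
proof -
  have "(\<Prod>b\<in>Basis. std_normal_density (z \<bullet> b)) = (\<Prod>b\<in>(Basis::'a set). 1 / sqrt (2 * pi)) * (\<Prod>b\<in>Basis. exp (- (z \<bullet> b)\<^sup>2 / 2))"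
    unfolding std_normal_density_def by (rule prod.distrib)
  also have "(\<Prod>b\<in>Basis. exp (- (z \<bullet> b)\<^sup>2 / 2)) = exp (\<Sum>b\<in>Basis. - (z \<bullet> b)\<^sup>2 / 2)"
    by (simp add: exp_sum)
  also have "(\<Sum>b\<in>Basis. - (z \<bullet> b)\<^sup>2 / 2) = - (norm z)\<^sup>2 / 2"
    unfolding power2_norm_eq_inner euclidean_inner[of z z]
    by (simp add: power2_eq_square sum_negf sum_divide_distrib)
  finally show ?thesis by (simp add: power_one_over)
qed

lemma axis_ne_0: "axis k 1 \<noteq> (0 :: real^'n)"
  by (simp add: axis_eq_0_iff)

text \<open>Normalization of the density is a locale assumption, discharged in the end by the law of
  a sample point. It is what fixes the Jacobian of the whitening map.\<close>

locale nondegenerate_gaussian =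
  fixes mu :: "real^'n" and S :: "real^'n^'n"
  assumes pos_def: "pos_def_matrix S" and prob_gauss: "prob_space (gauss_measure mu S)"
begin

abbreviation "m x \<equiv> mahal S x mu"
abbreviation "\<sigma> u \<equiv> sqrt (u \<bullet> (S *v u))"
abbreviation "G \<equiv> gauss_measure mu S"
definition "ellipsoid r = {x. m x \<le> r}"

sublocale G: prob_space G by (rule prob_gauss)

lemma sets_G [simp, measurable_cong]: "sets G = sets borel" by (simp add: gauss_measure_def)
lemma space_G [simp]: "space G = UNIV" by (simp add: gauss_measure_def)

lemma \<sigma>_pos: "u \<noteq> 0 \<Longrightarrow> \<sigma> u > 0"
  using pos_def_matrix_pos[OF pos_def] by simp

text \<open>Halfspaces with normal \<open>u\<close> become coordinate halfspaces, and the value of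
  \<open>L (axis k 1)\<close> allows a prescribed point to be placed on the axis.\<close>

lemma whitening:
  assumes u: "u \<noteq> 0"
  obtains L :: "real^'n \<Rightarrow> real^'n" where
    "linear L" "bij L" "\<And>z. m (mu + L z) = norm z" "\<And>z. u \<bullet> L z = \<sigma> u * z $ k"
    "L (axis k 1) = (S *v u) /\<^sub>R \<sigma> u"
    "\<And>f :: real^'n \<Rightarrow> ennreal. f \<in> borel_measurable borel \<Longrightarrow>
       (\<integral>\<^sup>+x. f x \<partial>lborel) = ennreal (sqrt (det S)) * (\<integral>\<^sup>+z. f (mu + L z) \<partial>lborel)"
    "\<And>z. gauss_density mu S (mu + L z) = (\<Prod>b\<in>Basis. std_normal_density (z \<bullet> b)) / sqrt (det S)"
    "sqrt (det S) > 0"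
proof -
  obtain L :: "real^'n \<Rightarrow> real^'n" where L: "linear L" "bij L"
    "\<And>z. L z \<bullet> (matrix_inv S *v L z) = z \<bullet> z" "\<And>z. u \<bullet> L z = \<sigma> u * z $ k"
    "L (axis k 1) = (S *v u) /\<^sub>R \<sigma> u"
    using pos_def_whitening[OF pos_def u] by metis
  obtain c where c: "c > 0" "\<And>f :: real^'n \<Rightarrow> ennreal. f \<in> borel_measurable borel \<Longrightarrow>
       (\<integral>\<^sup>+x. f x \<partial>lborel) = ennreal c * (\<integral>\<^sup>+z. f (mu + L z) \<partial>lborel)"
    using lborel_affine_bij[OF L(1,2), of mu] by metis
  have m: "m (mu + L z) = norm z" for z
    by (simp add: mahal_def L(3) norm_eq_sqrt_inner)
  have dens: "gauss_density mu S (mu + L z) = (\<Prod>b\<in>Basis. std_normal_density (z \<bullet> b)) / sqrt (det S)" for z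
    unfolding std_normal_prod_eq gauss_density_def m by (simp add: real_sqrt_mult real_sqrt_power power_mult_distrib)
  \<comment> \<open>The Jacobian of \<open>L\<close> is found by normalization: \<open>G\<close> has total mass one.\<close>
  have "1 = emeasure G UNIV" using G.emeasure_space_1 by simp
  also have "\<dots> = (\<integral>\<^sup>+x. ennreal (gauss_density mu S x) \<partial>lborel)"
    by (simp add: gauss_measure_def emeasure_density)
  also have "\<dots> = ennreal c * (\<integral>\<^sup>+z. ennreal (gauss_density mu S (mu + L z)) \<partial>lborel)"
    by (rule c(2)) measurable
  also have "\<dots> = ennreal c * (\<integral>\<^sup>+z. ennreal (1 / sqrt (det S)) * ennreal (\<Prod>b\<in>Basis. std_normal_density ((z::real^'n) \<bullet> b)) \<partial>lborel)"
    by (simp add: dens ennreal_mult''[symmetric] prod_nonneg)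
  also have "\<dots> = ennreal c * ennreal (1 / sqrt (det S))"
    by (simp add: nn_integral_cmult nn_integral_std_normal_prod_UNIV)
  also have "\<dots> = ennreal (c * (1 / sqrt (det S)))" by (rule ennreal_mult'[symmetric]) (use c in simp)
  finally have "c * (1 / sqrt (det S)) = 1"
    by (metis ennreal_1 ennreal_eq_1)
  \<comment> \<open>The sign of \<open>det S\<close> is unknown up to here: zero is excluded since
    \<open>1 / 0 = 0\<close>, and positivity then follows from \<open>c > 0\<close>.\<close>
  then have ceq: "c = sqrt (det S)" by (cases "sqrt (det S) = 0") (auto simp: field_simps)
  show ?thesis using that[OF L(1,2) m L(4,5) c(2)[unfolded ceq] dens] c(1) ceq by simp
qed

lemma sqrt_det_pos: "sqrt (det S) > 0"
  using whitening[OF axis_ne_0] by metis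

lemma measure_halfspace:
  assumes u: "u \<noteq> 0"
  shows "measure G {y. u \<bullet> y \<le> a} = Phi ((a - u \<bullet> mu) / \<sigma> u)"
proof -
  obtain k :: 'n where True by simp
  obtain L :: "real^'n \<Rightarrow> real^'n" where L: "linear L" "bij L" "\<And>z. m (mu + L z) = norm z" "\<And>z. u \<bullet> L z = \<sigma> u * z $ k"
    "\<And>f :: real^'n \<Rightarrow> ennreal. f \<in> borel_measurable borel \<Longrightarrow>
       (\<integral>\<^sup>+x. f x \<partial>lborel) = ennreal (sqrt (det S)) * (\<integral>\<^sup>+z. f (mu + L z) \<partial>lborel)"
    "\<And>z. gauss_density mu S (mu + L z) = (\<Prod>b\<in>Basis. std_normal_density (z \<bullet> b)) / sqrt (det S)"
    "sqrt (det S) > 0"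
    using whitening[OF u, of k] by metis
  let ?a = "(a - u \<bullet> mu) / \<sigma> u"
  have iff: "u \<bullet> (mu + L z) \<le> a \<longleftrightarrow> z \<bullet> axis k 1 \<le> ?a" for z
    using \<sigma>_pos[OF u] by (simp add: inner_add_right L(4) inner_axis field_simps)
  have [measurable]: "{y. u \<bullet> y \<le> a} \<in> sets borel" by measurable
  have "emeasure G {y. u \<bullet> y \<le> a} = (\<integral>\<^sup>+x. ennreal (gauss_density mu S x) * indicator {y. u \<bullet> y \<le> a} x \<partial>lborel)"
    unfolding gauss_measure_def by (rule emeasure_density) auto
  also have "\<dots> = ennreal (sqrt (det S)) * (\<integral>\<^sup>+z. ennreal (gauss_density mu S (mu + L z)) * indicator {y. u \<bullet> y \<le> a} (mu + L z) \<partial>lborel)"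
    by (rule L(5)) measurable
  also have "\<dots> = ennreal (sqrt (det S)) * (\<integral>\<^sup>+z. ennreal (1 / sqrt (det S)) * ennreal ((\<Prod>b\<in>Basis. std_normal_density ((z::real^'n) \<bullet> b)) * indicator {..?a} (z \<bullet> axis k 1)) \<partial>lborel)"
  proof (rule arg_cong2[where f = "(*)", OF refl], rule nn_integral_cong)
    fix z :: "real^'n"
    have "0 \<le> (\<Prod>b\<in>Basis. std_normal_density (z \<bullet> b))" by (simp add: prod_nonneg)
    then show "ennreal (gauss_density mu S (mu + L z)) * indicator {y. u \<bullet> y \<le> a} (mu + L z)
      = ennreal (1 / sqrt (det S)) * ennreal ((\<Prod>b\<in>Basis. std_normal_density (z \<bullet> b)) * indicator {..?a} (z \<bullet> axis k 1))"
      using iff[of z] by (cases "u \<bullet> (mu + L z) \<le> a") (simp_all add: L(6) ennreal_mult''[symmetric])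
  qed
  also have "\<dots> = ennreal (sqrt (det S)) * (ennreal (1 / sqrt (det S)) * ennreal (Phi ?a))"
    by (subst nn_integral_cmult) (auto simp: nn_integral_std_normal_prod axis_in_Basis_iff)
  also have "\<dots> = ennreal (Phi ?a)"
    using L(7) by (simp add: ennreal_mult'[symmetric] mult.assoc[symmetric])
  finally show ?thesis using Phi_pos[of ?a] by (simp add: measure_def)
qed

text \<open>In whitened coordinates this bounds a single coordinate by the norm.\<close>

lemma mahal_Cauchy_Schwarz: "\<bar>u \<bullet> (x - mu)\<bar> \<le> \<sigma> u * m x"
proof (cases "u = 0")
  case False
  obtain k :: 'n where True by simp
  obtain L :: "real^'n \<Rightarrow> real^'n" where L: "bij L" "\<And>z. m (mu + L z) = norm z" "\<And>z. u \<bullet> L z = \<sigma> u * z $ k"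
    using whitening[OF False, of k] by metis
  obtain z where z: "x - mu = L z" using L(1) by (metis bij_pointE)
  then have x: "x = mu + L z" by (simp add: algebra_simps)
  have "u \<bullet> (x - mu) = \<sigma> u * z $ k" by (simp only: z L(3))
  moreover have "m x = norm z" by (simp only: x L(2))
  ultimately show ?thesis
    using \<sigma>_pos[OF False] component_le_norm_cart[of z k] by (simp add: abs_mult mult_left_mono)
qed simp

lemma S_inv: "S *v (matrix_inv S *v x) = x"
  by (rule matrix_inv_mult_vec(2)[OF pos_def_matrix_invertible[OF pos_def]])

lemma \<sigma>_inv: "\<sigma> (matrix_inv S *v (x - mu)) = m x"
  by (simp add: S_inv mahal_def inner_commute)

lemma mahal_nonneg: "m x \<ge> 0"
  using mahal_Cauchy_Schwarz[of "axis k 1" x] \<sigma>_pos[OF axis_ne_0[of k]]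
  by (smt (verit) zero_le_mult_iff abs_ge_zero)

lemma inv_ne_0: "x \<noteq> mu \<Longrightarrow> matrix_inv S *v (x - mu) \<noteq> 0"
  by (metis S_inv eq_iff_diff_eq_0 matrix_vector_mult_0_right)

lemma mahal_pos: "x \<noteq> mu \<Longrightarrow> m x > 0"
  using \<sigma>_pos[OF inv_ne_0, of x] \<sigma>_inv[of x] by simp

lemma HD_gauss: "HD (measure G) x = Phi (- m x)"
proof (rule antisym)
  have bdd: "bdd_below (range (\<lambda>u. measure G {y. u \<bullet> y \<le> u \<bullet> x}))" by (intro bdd_belowI[of _ 0]) auto
  have "\<exists>u. measure G {y. u \<bullet> y \<le> u \<bullet> x} \<le> Phi (- m x)"
  proof (cases "x = mu")
    case True
    obtain k :: 'n where True by simp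
    have "measure G {y. axis k 1 \<bullet> y \<le> axis k 1 \<bullet> x} = Phi (- m x)"
      by (simp add: measure_halfspace[OF axis_ne_0] True mahal_def)
    then show ?thesis by (metis order_refl)
  next
    case False
    \<comment> \<open>The minimizing direction is \<open>- v\<close>, the equality case of
      Cauchy--Schwarz: the halfspace bounded by the hyperplane through \<open>x\<close> that points
      away from \<open>mu\<close>.\<close>
    define v where "v = matrix_inv S *v (x - mu)"
    have v: "v \<noteq> 0" "\<sigma> v = m x" unfolding v_def using inv_ne_0[OF False] \<sigma>_inv by auto
    have "v \<bullet> (x - mu) = (m x)\<^sup>2"
      using v(2) mahal_pos[OF False] unfolding v_def[symmetric]
      by (simp add: v_def S_inv mahal_def inner_commute)
    then have "v \<bullet> mu - v \<bullet> x = - (m x)\<^sup>2" by (simp add: inner_diff_right)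
    then have "measure G {y. (- v) \<bullet> y \<le> (- v) \<bullet> x} = Phi (- (m x)\<^sup>2 / m x)"
      using v by (subst measure_halfspace) (auto simp: linear_neg[OF matrix_vector_mul_linear] inner_diff_right)
    also have "- (m x)\<^sup>2 / m x = - m x" using mahal_pos[OF False] by (simp add: power2_eq_square)
    finally show ?thesis by (metis order_refl)
  qed
  then show "HD (measure G) x \<le> Phi (- m x)"
    unfolding HD_def using cINF_lower2[OF bdd UNIV_I] by blast
  show "Phi (- m x) \<le> HD (measure G) x"
    unfolding HD_def
  proof (rule cINF_greatest)
    fix u
    show "Phi (- m x) \<le> measure G {y. u \<bullet> y \<le> u \<bullet> x}"
    \<comment> \<open>The infimum includes \<open>u = 0\<close>, whose halfspace is the whole space
      and has mass one.\<close>
    proof (cases "u = 0")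
      case True
      then show ?thesis using G.prob_space Phi_less_1[of "- m x"] by simp
    next
      case False
      have "- m x \<le> (u \<bullet> x - u \<bullet> mu) / \<sigma> u"
        using mahal_Cauchy_Schwarz[of u x] \<sigma>_pos[OF False]
        by (simp add: field_simps inner_diff_right abs_le_iff)
      then show ?thesis by (simp add: measure_halfspace[OF False])
    qed
  qed simp
qed

text \<open>The radius is absorbed into the linear map, so that \<open>ellipsoid r\<close>
  corresponds to the unit ball.\<close>

lemma emeasure_whitened:
  assumes u: "u \<noteq> 0" and r: "r > 0"
  obtains L :: "real^'n \<Rightarrow> real^'n" where
    "linear L" "bij L" "\<And>z. m (mu + L z) = r * norm z"
    "L (axis k 1) = (r / \<sigma> u) *\<^sub>R (S *v u)"
    "\<And>X. X \<in> sets borel \<Longrightarrow>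
       emeasure lborel X = ennreal (sqrt (det S) * r ^ CARD('n)) * emeasure lborel ((\<lambda>z. mu + L z) -` X)"
proof -
  obtain L :: "real^'n \<Rightarrow> real^'n" where L: "linear L" "bij L" "\<And>z. m (mu + L z) = norm z" "\<And>z. u \<bullet> L z = \<sigma> u * z $ k"
    "L (axis k 1) = (S *v u) /\<^sub>R \<sigma> u"
    "\<And>f :: real^'n \<Rightarrow> ennreal. f \<in> borel_measurable borel \<Longrightarrow>
       (\<integral>\<^sup>+x. f x \<partial>lborel) = ennreal (sqrt (det S)) * (\<integral>\<^sup>+z. f (mu + L z) \<partial>lborel)"
    "\<And>z. gauss_density mu S (mu + L z) = (\<Prod>b\<in>Basis. std_normal_density (z \<bullet> b)) / sqrt (det S)"
    "sqrt (det S) > 0"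
    by (fact whitening[OF u, of k])
  have contL: "continuous_on UNIV L"
    using L(1) by (simp add: linear_continuous_on linear_conv_bounded_linear)
  have "bij (\<lambda>z :: real^'n. r *\<^sub>R z)"
    using r by (intro bij_betw_byWitness[where f' = "\<lambda>z. (1 / r) *\<^sub>R z"]) auto
  then have bij: "bij (\<lambda>z. L (r *\<^sub>R z))" using bij_comp[OF _ L(2)] by (simp add: o_def)
  show ?thesis
  proof (rule that[OF _ bij])
    show "linear (\<lambda>z. L (r *\<^sub>R z))"
      using L(1) by (intro linearI) (simp_all add: linear_add linear_scale scaleR_add_right)
    show "m (mu + L (r *\<^sub>R z)) = r * norm z" for z using r by (simp add: L(3))
    show "L (r *\<^sub>R axis k 1) = (r / \<sigma> u) *\<^sub>R (S *v u)"
      using L(1,5) by (simp add: linear_scale divide_inverse)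
    fix X :: "(real^'n) set" assume X [measurable]: "X \<in> sets borel"
    have [measurable]: "(\<lambda>z. mu + L z) \<in> borel_measurable borel" "(\<lambda>z. mu + L (r *\<^sub>R z)) \<in> borel_measurable borel"
      using contL by (auto intro!: borel_measurable_continuous_onI continuous_intros continuous_on_compose2[OF contL])
    have "emeasure lborel X = (\<integral>\<^sup>+x. indicator X x \<partial>lborel)" by simp
    also have "\<dots> = ennreal (sqrt (det S)) * (\<integral>\<^sup>+z. indicator X (mu + L z) \<partial>lborel)"
      by (rule L(6)) measurable
    also have "(\<integral>\<^sup>+z. indicator X (mu + L z) \<partial>lborel)
       = (\<integral>\<^sup>+z. indicator X (mu + L z) \<partial>density (distr lborel borel (\<lambda>z. 0 + r *\<^sub>R z)) (\<lambda>_. \<bar>r\<bar> ^ DIM(real^'n)))"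
      using lborel_affine[of r "0 :: real^'n"] r by simp
    also have "\<dots> = ennreal (r ^ CARD('n)) * (\<integral>\<^sup>+z. indicator X (mu + L (r *\<^sub>R z)) \<partial>lborel)"
      using r by (simp add: nn_integral_density nn_integral_distr nn_integral_cmult)
    also have "(\<integral>\<^sup>+z. indicator X (mu + L (r *\<^sub>R z)) \<partial>lborel) = (\<integral>\<^sup>+z. indicator ((\<lambda>z. mu + L (r *\<^sub>R z)) -` X) z \<partial>lborel)"
      by (intro nn_integral_cong) (auto simp: indicator_def)
    also have "\<dots> = emeasure lborel ((\<lambda>z. mu + L (r *\<^sub>R z)) -` X)"
      using measurable_sets[of "\<lambda>z. mu + L (r *\<^sub>R z)" borel borel X] by simp
    finally show "emeasure lborel X = ennreal (sqrt (det S) * r ^ CARD('n)) * emeasure lborel ((\<lambda>z. mu + L (r *\<^sub>R z)) -` X)"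
      using sqrt_det_pos r by (simp add: ennreal_mult' mult.assoc)
  qed
qed

section \<open>Mahalanobis balls: convexity, volume and illumination\<close>

lemma ellipsoid_eq_image:
  assumes L: "bij L" "\<And>z. m (mu + L z) = r * norm z" and r: "r > 0"
  shows "ellipsoid r = (\<lambda>z. mu + L z) ` cball 0 1"
proof (intro set_eqI iffI)
  fix x assume x: "x \<in> ellipsoid r"
  obtain z where "x - mu = L z" using L(1) by (metis bij_pointE)
  then have z: "x = mu + L z" by (simp add: algebra_simps)
  then have "r * norm z \<le> r * 1" using x by (simp add: ellipsoid_def L(2))
  then show "x \<in> (\<lambda>z. mu + L z) ` cball 0 1" using r z by auto
qed (use r in \<open>auto simp: ellipsoid_def L(2)\<close>)

lemma convex_compact_ellipsoid:
  assumes r: "r > 0" shows "convex (ellipsoid r)" "compact (ellipsoid r)"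
proof -
  obtain k :: 'n where True by simp
  obtain L :: "real^'n \<Rightarrow> real^'n" where L: "linear L" "bij L" "\<And>z. m (mu + L z) = r * norm z"
    using emeasure_whitened[OF axis_ne_0[of k] r, of k] by metis
  have E: "ellipsoid r = (+) mu ` (L ` cball 0 1)"
    using ellipsoid_eq_image[OF L(2,3) r] by (simp add: image_image)
  show "convex (ellipsoid r)" unfolding E
    using L(1) by (intro convex_translation convex_linear_image) auto
  show "compact (ellipsoid r)" unfolding E
    using L(1) by (intro compact_translation compact_continuous_image linear_continuous_on)
      (auto simp: linear_conv_bounded_linear)
qed

lemma Ill_ellipsoid_eq:
  assumes r: "r > 0"
  shows "Ill x (ellipsoid r) = sqrt (det S) * unit_ball_vol CARD('n) * r ^ CARD('n) * g_fun CARD('n) (max 1 (m x / r))"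
proof -
  obtain k :: 'n where True by simp
  \<comment> \<open>For \<open>x \<noteq> mu\<close> this gives \<open>S *v v = x - mu\<close>, so
    the axis is mapped to the ray from \<open>mu\<close> through \<open>x\<close>, on which
    \<open>x\<close> has coordinate \<open>m x / r\<close>. At \<open>x = mu\<close> any direction
    serves.\<close>
  define v where "v = (if x = mu then axis k 1 else matrix_inv S *v (x - mu))"
  have v: "v \<noteq> 0" using axis_ne_0 inv_ne_0 by (simp add: v_def)
  obtain L :: "real^'n \<Rightarrow> real^'n" where L: "linear L" "bij L" "\<And>z. m (mu + L z) = r * norm z"
    "L (axis k 1) = (r / \<sigma> v) *\<^sub>R (S *v v)"
    "\<And>X. X \<in> sets borel \<Longrightarrow>
       emeasure lborel X = ennreal (sqrt (det S) * r ^ CARD('n)) * emeasure lborel ((\<lambda>z. mu + L z) -` X)"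
    by (fact emeasure_whitened[OF v r, of k])
  have x: "x = mu + L ((m x / r) *\<^sub>R axis k 1)"
  proof (cases "x = mu")
    case True
    then show ?thesis using L(1) by (simp add: mahal_def linear_0)
  next
    case False
    then have "L (axis k 1) = (r / m x) *\<^sub>R (x - mu)" using L(4) by (simp add: v_def S_inv \<sigma>_inv[unfolded S_inv])
    then show ?thesis using mahal_pos[OF False] r by (simp add: linear_scale[OF L(1)])
  qed
  let ?T = "\<lambda>z. mu + L z"
  define t where "t = m x / r"
  let ?e = "axis k 1 :: real^'n"
  have t0: "t \<ge> 0" using mahal_nonneg r by (simp add: t_def)
  have E: "ellipsoid r = ?T ` cball 0 1" by (rule ellipsoid_eq_image[OF L(2,3) r])
  have "inj ?T" using L(2) by (auto simp: inj_def bij_def)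
  have hull: "convex hull (ellipsoid r \<union> {x}) = ?T ` (convex hull (cball 0 1 \<union> {t *\<^sub>R ?e}))"
  proof -
    have "convex hull (ellipsoid r \<union> {x}) = convex hull ((+) mu ` (L ` (cball 0 1 \<union> {t *\<^sub>R ?e})))"
      using x by (intro arg_cong[where f = "\<lambda>A. convex hull A"]) (auto simp: E t_def)
    also have "\<dots> = (+) mu ` (L ` (convex hull (cball 0 1 \<union> {t *\<^sub>R ?e})))"
      by (simp only: convex_hull_translation convex_hull_linear_image[OF L(1)])
    finally show ?thesis by (simp add: image_image)
  qed
  \<comment> \<open>A point of the ball adds nothing to the hull, so \<open>t < 1\<close> may be
    raised to 1; hence the \<open>max\<close> in the formula.\<close>
  have ball_hull: "convex hull (cball 0 1 \<union> {t *\<^sub>R ?e}) = convex hull (cball 0 1 \<union> {max 1 t *\<^sub>R ?e})"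
  proof (cases "t \<ge> 1")
    case False
    then have "t *\<^sub>R ?e \<in> cball 0 1" "max 1 t *\<^sub>R ?e \<in> cball 0 1" using t0 by auto
    then show ?thesis by (simp add: insert_absorb)
  qed (simp add: max_def)
  have "compact (convex hull (ellipsoid r \<union> {x}))"
    using convex_compact_ellipsoid[OF r] by (intro compact_convex_hull compact_Un) auto
  then have "convex hull (ellipsoid r \<union> {x}) \<in> sets borel" by (rule borel_compact)
  from L(5)[OF this] have "emeasure lborel (convex hull (ellipsoid r \<union> {x}))
     = ennreal (sqrt (det S) * r ^ CARD('n)) * emeasure lborel (convex hull (cball 0 1 \<union> {max 1 t *\<^sub>R ?e}))"
    by (simp only: hull ball_hull inj_vimage_image_eq[OF \<open>inj ?T\<close>])
  also have "emeasure lborel (convex hull (cball 0 1 \<union> {max 1 t *\<^sub>R ?e})) = ennreal (unit_ball_vol CARD('n) * g_fun CARD('n) (max 1 t))"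
    using emeasure_convex_hull_cball_insert[of ?e "max 1 t"] by (simp add: axis_in_Basis_iff)
  also have "ennreal (sqrt (det S) * r ^ CARD('n)) * \<dots>
     = ennreal (sqrt (det S) * unit_ball_vol CARD('n) * r ^ CARD('n) * g_fun CARD('n) (max 1 t))"
    using sqrt_det_pos r by (subst ennreal_mult'[symmetric]) (auto simp: mult_ac)
  finally show ?thesis
    using g_fun_mono[of 1 "max 1 t" "CARD('n)"] sqrt_det_pos r
    by (simp add: Ill_def vol_def measure_def t_def g_fun_1)
qed

text \<open>The illumination from the centre, where the hull adds nothing and \<open>g_fun\<close>
  equals 1.\<close>

lemma vol_ellipsoid:
  assumes r: "r > 0"
  shows "vol (ellipsoid r) = sqrt (det S) * unit_ball_vol CARD('n) * r ^ CARD('n)"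
proof -
  have "mu \<in> ellipsoid r" using r by (simp add: ellipsoid_def mahal_def)
  then have "Ill mu (ellipsoid r) = vol (ellipsoid r)"
    using convex_compact_ellipsoid(1)[OF r] by (simp add: Ill_def insert_absorb hull_same)
  moreover have "m mu = 0" by (simp add: mahal_def)
  ultimately show ?thesis using Ill_ellipsoid_eq[OF r, of mu] by (simp add: g_fun_1)
qed

lemma Ill_ellipsoid:
  "r > 0 \<Longrightarrow> Ill x (ellipsoid r) = vol (ellipsoid r) * g_fun CARD('n) (max 1 (m x / r))"
  by (simp add: Ill_ellipsoid_eq vol_ellipsoid)

lemma vol_ellipsoid_pos: "r > 0 \<Longrightarrow> vol (ellipsoid r) > 0"
  by (simp add: vol_ellipsoid sqrt_det_pos[simplified])

lemma depth_region_gauss: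
  assumes "Phi (- r) = \<delta>"
  shows "depth_region (measure G) \<delta> = ellipsoid r"
  unfolding depth_region_def HD_gauss ellipsoid_def assms[symmetric] by simp

end

subsection \<open>Uniform convergence of the empirical depth\<close>

lemma abs_INF_diff_le:
  fixes f g :: "'a \<Rightarrow> real"
  assumes "\<And>u. \<bar>f u - g u\<bar> \<le> \<eta>" "bdd_below (range f)" "bdd_below (range g)"
  shows "\<bar>(INF u. f u) - (INF u. g u)\<bar> \<le> \<eta>"
proof -
  have "(INF u. g u) - \<eta> \<le> (INF u. f u)"
  proof (rule cINF_greatest)
    fix u
    have "(INF u. g u) \<le> g u" using assms(3) by (rule cINF_lower) simp
    then show "(INF u. g u) - \<eta> \<le> f u" using assms(1)[of u] by linarith
  qed simp
  moreover have "(INF u. f u) - \<eta> \<le> (INF u. g u)"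
  proof (rule cINF_greatest)
    fix u
    have "(INF u. f u) \<le> f u" using assms(2) by (rule cINF_lower) simp
    then show "(INF u. f u) - \<eta> \<le> g u" using assms(1)[of u] by linarith
  qed simp
  ultimately show ?thesis by linarith
qed

lemma empirical_nonneg: "empirical n xs A \<ge> 0"
  by (simp add: empirical_def)

lemma empirical_mono: "A \<subseteq> B \<Longrightarrow> empirical n xs A \<le> empirical n xs B"
  unfolding empirical_def by (intro divide_right_mono of_nat_mono card_mono) auto

lemma empirical_UNIV: "n > 0 \<Longrightarrow> empirical n xs UNIV = 1"
  by (simp add: empirical_def)

lemma empirical_eq_sum: "empirical n xs B = (\<Sum>i<n. indicator B (xs i)) / real n"
proof -
  have "{i. i < n \<and> xs i \<in> B} = {i \<in> {..<n}. xs i \<in> B}" by auto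
  then show ?thesis by (simp add: empirical_def indicator_def sum.If_cases Int_def)
qed

text \<open>Each halfspace frequency is upper semicontinuous in \<open>x\<close>: its superlevel set
  is a finite union, over large enough index sets, of intersections of closed halfspaces. Closedness
  later yields the compactness used in comparing volumes.\<close>

lemma closed_depth_region_empirical: "closed (depth_region (empirical n xs) \<delta>)"
proof -
  let ?c = "\<lambda>u x. empirical n xs {y. u \<bullet> y \<le> u \<bullet> x}"
  have "depth_region (empirical n xs) \<delta> = (\<Inter>u. {x. \<delta> \<le> ?c u x})"
  proof -
    have "bdd_below (range (\<lambda>u. ?c u x))" for x
      by (intro bdd_belowI[of _ 0]) (auto simp: empirical_nonneg)
    then show ?thesis
      unfolding depth_region_def HD_def by (auto simp: le_cINF_iff)
  qed
  moreover have "closed {x. \<delta> \<le> ?c u x}" for u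
  proof -
    let ?J = "{J. J \<subseteq> {..<n} \<and> \<delta> \<le> real (card J) / real n}"
    have "{x. \<delta> \<le> ?c u x} = (\<Union>J\<in>?J. \<Inter>i\<in>J. {x. u \<bullet> xs i \<le> u \<bullet> x})"
    proof (intro set_eqI iffI)
      fix x assume "x \<in> {x. \<delta> \<le> ?c u x}"
      then show "x \<in> (\<Union>J\<in>?J. \<Inter>i\<in>J. {x. u \<bullet> xs i \<le> u \<bullet> x})"
        by (intro UN_I[of "{i. i < n \<and> u \<bullet> xs i \<le> u \<bullet> x}"]) (auto simp: empirical_def)
    next
      fix x assume "x \<in> (\<Union>J\<in>?J. \<Inter>i\<in>J. {x. u \<bullet> xs i \<le> u \<bullet> x})"
      then obtain J where J: "J \<subseteq> {..<n}" "\<delta> \<le> real (card J) / real n" "\<And>i. i \<in> J \<Longrightarrow> u \<bullet> xs i \<le> u \<bullet> x"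
        by auto
      have "card J \<le> card {i. i < n \<and> xs i \<in> {y. u \<bullet> y \<le> u \<bullet> x}}"
        using J by (intro card_mono) auto
      then have "real (card J) / real n \<le> ?c u x"
        unfolding empirical_def by (intro divide_right_mono) auto
      then show "x \<in> {x. \<delta> \<le> ?c u x}" using J(2) by simp
    qed
    moreover have "finite ?J" by (rule finite_subset[of _ "Pow {..<n}"]) auto
    moreover have "closed (\<Inter>i\<in>J. {x. u \<bullet> xs i \<le> u \<bullet> x})" for J
      by (intro closed_INT ballI closed_Collect_le continuous_intros)
    ultimately show ?thesis by (simp add: closed_UN)
  qed
  ultimately show ?thesis by auto
qed

text \<open>Hoeffding's inequality for the iid indicators \<open>Y i\<close>. The event is also
  recorded as measurable, since such events are united later.\<close>

lemma (in prob_space) empirical_deviation: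
  assumes indep: "indep_vars (\<lambda>_. borel) X UNIV"
    and distr: "\<And>i. distr M borel (X i) = Q" and B: "B \<in> sets borel" and n: "n > 0" and "\<epsilon> \<ge> 0"
  shows "prob {\<omega> \<in> space M. \<bar>empirical n (\<lambda>i. X i \<omega>) B - measure Q B\<bar> \<ge> \<epsilon>} \<le> 2 * exp (- 2 * real n * \<epsilon>\<^sup>2)"
    and "{\<omega> \<in> space M. \<bar>empirical n (\<lambda>i. X i \<omega>) B - measure Q B\<bar> \<ge> \<epsilon>} \<in> events"
proof -
  note B [measurable]
  have X [measurable]: "X i \<in> borel_measurable M" for i
    using indep by (auto simp: indep_vars_def)
  define Y where "Y i \<omega> = (indicator B (X i \<omega>) :: real)" for i \<omega>
  have Y [measurable]: "Y i \<in> borel_measurable M" for i unfolding Y_def by measurable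
  have "indep_vars (\<lambda>_. borel) Y UNIV"
    unfolding Y_def by (rule indep_vars_compose2[OF indep]) measurable
  then have indepY: "indep_vars (\<lambda>_. borel) Y {..<n}" by (rule indep_vars_subset) simp
  have distrY: "distr M borel (Y i) = distr Q borel (indicator B)" for i
    unfolding Y_def distr[of i, symmetric] by (subst distr_distr) (auto simp: o_def)
  have "expectation (Y 0) = prob {\<omega> \<in> space M. X 0 \<omega> \<in> B}"
  proof -
    have "expectation (Y 0) = expectation (indicator {\<omega> \<in> space M. X 0 \<omega> \<in> B})"
      by (intro Bochner_Integration.integral_cong) (auto simp: Y_def indicator_def)
    also have "\<dots> = prob {\<omega> \<in> space M. X 0 \<omega> \<in> B}" by (subst Bochner_Integration.integral_indicator) (auto simp: Int_def conj_commute)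
    finally show ?thesis .
  qed
  also have "\<dots> = measure Q B"
    unfolding distr[of 0, symmetric] by (subst measure_distr) (auto simp: vimage_def Int_def conj_commute)
  finally have EY: "expectation (Y 0) = measure Q B" .
  interpret H: Hoeffding_ineq_iid M "{..<n}" Y "Y 0" 0 1 "expectation (Y 0)"
    by unfold_locales (auto simp: indepY distrY Y_def indicator_def)
  have eq: "empirical n (\<lambda>i. X i \<omega>) B = (\<Sum>i<n. Y i \<omega>) / real n" for \<omega>
    by (simp add: empirical_eq_sum Y_def)
  show "prob {\<omega> \<in> space M. \<bar>empirical n (\<lambda>i. X i \<omega>) B - measure Q B\<bar> \<ge> \<epsilon>} \<le> 2 * exp (- 2 * real n * \<epsilon>\<^sup>2)"
    using H.Hoeffding_ineq_abs_ge'[OF \<open>\<epsilon> \<ge> 0\<close>] n by (simp add: eq EY lessThan_empty_iff)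
  show "{\<omega> \<in> space M. \<bar>empirical n (\<lambda>i. X i \<omega>) B - measure Q B\<bar> \<ge> \<epsilon>} \<in> events"
    unfolding eq by measurable
qed

section \<open>Bracketing of all halfspaces and the uniform law for the depth\<close>

context nondegenerate_gaussian
begin

lemma compact_unit_\<sigma>: "compact {u. \<sigma> u = 1}"
proof -
  obtain B where B: "B > 0" "\<And>u. norm (matrix_inv S *v u) \<le> norm u * B"
    using bounded_linear.pos_bounded[OF matrix_vector_mul_bounded_linear[of "matrix_inv S"]] by blast
  have "norm u \<le> sqrt B" if "\<sigma> u = 1" for u
  proof (cases "u = 0")
    case False
    \<comment> \<open>In place of an eigenvalue bound for \<open>S\<close>,
      \<open>mahal_Cauchy_Schwarz\<close> is tested at the point \<open>mu + u\<close>: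
      \<open>(norm u)\<^sup>2\<close> is at most \<open>m (mu + u)\<close>, whose square is at most
      \<open>(norm u)\<^sup>2 * B\<close>.\<close>
    have "(norm u)\<^sup>2 = \<bar>u \<bullet> ((mu + u) - mu)\<bar>" by (simp add: power2_norm_eq_inner)
    also have "\<dots> \<le> m (mu + u)" using mahal_Cauchy_Schwarz[of u "mu + u"] that by simp
    finally have "((norm u)\<^sup>2)\<^sup>2 \<le> (m (mu + u))\<^sup>2" by (intro power_mono) auto
    also have "\<dots> = u \<bullet> (matrix_inv S *v u)"
      using mahal_nonneg[of "mu + u"] by (simp add: mahal_def)
    also have "\<dots> \<le> norm u * norm (matrix_inv S *v u)" by (rule norm_cauchy_schwarz)
    also have "\<dots> \<le> norm u * (norm u * B)" using B by (intro mult_left_mono) auto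
    finally have "(norm u)\<^sup>2 * (norm u)\<^sup>2 \<le> (norm u)\<^sup>2 * B" by (simp add: power2_eq_square mult_ac)
    moreover have "(norm u)\<^sup>2 > 0" using False by simp
    ultimately have "(norm u)\<^sup>2 \<le> B" by (rule mult_left_le_imp_le)
    then show ?thesis by (rule real_le_rsqrt)
  qed (use B in simp)
  then have "bounded {u. \<sigma> u = 1}" by (auto simp: bounded_iff)
  moreover have "closed {u. \<sigma> u = 1}"
    by (intro closed_Collect_eq continuous_intros bounded_linear.continuous_on[OF matrix_vector_mul_bounded_linear])
  ultimately show ?thesis by (simp add: compact_eq_bounded_closed)
qed

text \<open>A ball \<open>D\<close> carries all but \<open>\<eta> / 2\<close> of the mass. On
  \<open>D\<close> a halfspace varies, up to a thin slab, continuously with its normal and offset,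
  which range over a compact set after normalization; off \<open>D\<close> the bracket concedes
  everything.\<close>

lemma finite_halfspace_brackets:
  assumes \<eta>: "\<eta> > 0"
  obtains F where "finite F" "F \<subseteq> sets borel"
    "\<And>u a. u \<noteq> 0 \<Longrightarrow> \<exists>A\<in>F. \<exists>B\<in>F. A \<subseteq> {y. u \<bullet> y \<le> a} \<and> {y. u \<bullet> y \<le> a} \<subseteq> B
       \<and> measure G B - measure G A \<le> \<eta>"
proof -
  have "(\<lambda>n. measure G (cball 0 (real n))) \<longlonglongrightarrow> measure G (\<Union>n. cball 0 (real n))"
    by (intro G.finite_Lim_measure_incseq) (auto simp: incseq_def)
  also have "(\<Union>n. cball (0::real^'n) (real n)) = UNIV" by (auto simp: real_arch_simple)
  also have "measure G UNIV = 1" using G.prob_space by simp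
  finally have "\<forall>\<^sub>F n in sequentially. measure G (cball 0 (real n)) > 1 - \<eta> / 2"
    by (rule order_tendstoD) (use \<eta> in simp)
  then obtain n where n: "measure G (cball 0 (real n)) > 1 - \<eta> / 2"
    using eventually_happens sequentially_bot by blast
  define R where "R = real n"
  have R: "R \<ge> 0" "measure G (cball 0 R) > 1 - \<eta> / 2" using n by (auto simp: R_def)
  define D where "D = cball (0::real^'n) R"
  have D [measurable]: "D \<in> sets borel" by (simp add: D_def)
  have out: "measure G (- D) < \<eta> / 2"
    using R(2) G.prob_compl[of D] by (simp add: D_def Compl_eq_Diff_UNIV)
  obtain C where C: "\<And>u. \<sigma> u = 1 \<Longrightarrow> norm u \<le> C"
    using compact_imp_bounded[OF compact_unit_\<sigma>] by (auto simp: bounded_iff)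
  define H where "H u a = {y :: real^'n. u \<bullet> y \<le> a}" for u a
  have H [measurable]: "H u a \<in> sets borel" for u a unfolding H_def by measurable
  \<comment> \<open>Offsets beyond \<open>C * R\<close> cut \<open>D\<close> trivially and are
    served by \<open>D\<close>, \<open>UNIV\<close>, \<open>{}\<close> and \<open>- D\<close>. With
    \<open>\<sigma> u = 1\<close> the argument of \<open>Phi\<close> has slope 1 in the
    offset.\<close>
  define W where "W = {u. \<sigma> u = 1} \<times> {- (C * R)..C * R}"
  \<comment> \<open>The bracket width is at most \<open>\<eta> / 2\<close> off \<open>D\<close> plus
    \<open>2 * \<kappa>\<close> for the slab. The net radius satisfies
    \<open>\<rho> * R + \<rho> = \<kappa>\<close>: error of the normal on \<open>D\<close> plus
    error of the offset.\<close>
  define \<kappa> where "\<kappa> = \<eta> / 8"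
  define \<rho> where "\<rho> = \<kappa> / (R + 1)"
  have "\<rho> * (R + 1) = \<kappa>" using R by (simp add: \<rho>_def)
  then have "\<rho> * R + \<rho> = \<kappa>" by (simp only: distrib_left mult_1_right)
  moreover have "\<rho> > 0" using \<eta> R by (simp add: \<rho>_def \<kappa>_def)
  ultimately have \<rho>: "\<rho> > 0" "\<rho> * R + \<rho> = \<kappa>" by auto
  have "compact W" unfolding W_def by (intro compact_Times compact_unit_\<sigma>) simp
  then obtain K where K: "K \<subseteq> W" "finite K" "W \<subseteq> (\<Union>k\<in>K. ball k \<rho>)"
    by (rule compactE_image[of W W "\<lambda>k. ball k \<rho>"]) (use \<rho>(1) in force)+
  define F where "F = {D, UNIV, {}, - D} \<union> (\<lambda>(u, a). D \<inter> H u (a - \<kappa>)) ` K \<union> (\<lambda>(u, a). - D \<union> H u (a + \<kappa>)) ` K"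
  have normalized: "\<exists>A\<in>F. \<exists>B\<in>F. A \<subseteq> H u a \<and> H u a \<subseteq> B \<and> measure G B - measure G A \<le> \<eta>"
    if u: "\<sigma> u = 1" for u a
  proof -
    have uy: "\<bar>u \<bullet> y\<bar> \<le> C * R" if "y \<in> D" for y
    proof -
      have "\<bar>u \<bullet> y\<bar> \<le> norm u * norm y" by (rule Cauchy_Schwarz_ineq2)
      also have "\<dots> \<le> C * R" using C[OF u] that R by (intro mult_mono') (auto simp: D_def)
      finally show ?thesis .
    qed
    consider "a > C * R" | "a < - (C * R)" | "(u, a) \<in> W" using u by (force simp: W_def)
    then show ?thesis
    proof cases
      case 1
      have "D \<subseteq> H u a" using uy 1 by (fastforce simp: H_def)
      moreover have "measure G UNIV - measure G D \<le> \<eta>" using R(2) \<eta> G.prob_space by (simp add: D_def)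
      ultimately show ?thesis by (intro bexI[of _ D] bexI[of _ UNIV]) (auto simp: F_def)
    next
      case 2
      have "H u a \<subseteq> - D" using uy 2 by (fastforce simp: H_def)
      moreover have "measure G (- D) - measure G {} \<le> \<eta>" using out \<eta> by simp
      ultimately show ?thesis by (intro bexI[of _ "{}"] bexI[of _ "- D"]) (auto simp: F_def)
    next
      case 3
      then obtain v b where vb: "(v, b) \<in> K" "dist (v, b) (u, a) < \<rho>" using K(3) by auto
      have v: "\<sigma> v = 1" using vb(1) K(1) by (auto simp: W_def)
      then have v0: "v \<noteq> 0" by auto
      have uv: "norm (u - v) < \<rho>"
        using vb(2) dist_fst_le[of "(v, b)" "(u, a)"] by (simp add: dist_norm norm_minus_commute)
      have ab: "\<bar>a - b\<bar> < \<rho>"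
        using vb(2) dist_snd_le[of "(v, b)" "(u, a)"] by (simp add: dist_real_def abs_minus_commute)
      have close: "\<bar>u \<bullet> y - v \<bullet> y\<bar> \<le> \<rho> * R" if "y \<in> D" for y
      proof -
        have "\<bar>(u - v) \<bullet> y\<bar> \<le> norm (u - v) * norm y" by (rule Cauchy_Schwarz_ineq2)
        also have "\<dots> \<le> \<rho> * R" using uv that R by (intro mult_mono') (auto simp: D_def)
        finally show ?thesis by (simp add: inner_diff_left)
      qed
      let ?A = "D \<inter> H v (b - \<kappa>)" and ?B = "- D \<union> H v (b + \<kappa>)"
      have AH: "?A \<subseteq> H u a"
      proof
        fix y assume y: "y \<in> ?A"
        then have "v \<bullet> y \<le> b - \<kappa>" "\<bar>u \<bullet> y - v \<bullet> y\<bar> \<le> \<rho> * R" using close by (auto simp: H_def)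
        then show "y \<in> H u a" using ab \<rho>(2) unfolding H_def mem_Collect_eq by linarith
      qed
      have HB: "H u a \<subseteq> ?B"
      proof
        fix y assume y: "y \<in> H u a"
        show "y \<in> ?B"
        proof (cases "y \<in> D")
          case True
          have "u \<bullet> y \<le> a" "\<bar>u \<bullet> y - v \<bullet> y\<bar> \<le> \<rho> * R" using y close[OF True] by (auto simp: H_def)
          then have "v \<bullet> y \<le> b + \<kappa>" using ab \<rho>(2) by linarith
          then show ?thesis by (simp add: H_def)
        qed simp
      qed
      have slab: "measure G (H v (b + \<kappa>) - H v (b - \<kappa>)) \<le> 2 * \<kappa>"
      proof -
        have "measure G (H v (b + \<kappa>) - H v (b - \<kappa>)) = measure G (H v (b + \<kappa>)) - measure G (H v (b - \<kappa>))"
          using \<eta> by (intro G.finite_measure_Diff) (auto simp: H_def \<kappa>_def)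
        also have "\<dots> = Phi (b + \<kappa> - v \<bullet> mu) - Phi (b - \<kappa> - v \<bullet> mu)"
          unfolding H_def measure_halfspace[OF v0] v by simp
        also have "\<dots> \<le> (b + \<kappa> - v \<bullet> mu) - (b - \<kappa> - v \<bullet> mu)"
          using \<eta> by (intro Phi_diff_le) (simp add: \<kappa>_def)
        finally show ?thesis by simp
      qed
      have "measure G ?B \<le> measure G ((?A \<union> - D) \<union> (H v (b + \<kappa>) - H v (b - \<kappa>)))"
        by (intro G.finite_measure_mono) auto
      also have "\<dots> \<le> measure G (?A \<union> - D) + measure G (H v (b + \<kappa>) - H v (b - \<kappa>))"
        by (intro measure_Un_le) auto
      also have "measure G (?A \<union> - D) \<le> measure G ?A + measure G (- D)"
        by (intro measure_Un_le) auto
      finally have "measure G ?B - measure G ?A \<le> \<eta>" using slab out \<eta> by (simp add: \<kappa>_def)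
      moreover have "?A \<in> F" "?B \<in> F" using vb(1) by (force simp: F_def)+
      ultimately show ?thesis using AH HB by blast
    qed
  qed
  show ?thesis
  proof (rule that)
    show "finite F" using K(2) by (simp add: F_def)
    show "F \<subseteq> sets borel" by (auto simp: F_def)
    fix u :: "real^'n" and a assume u: "u \<noteq> 0"
    have s: "\<sigma> u > 0" by (rule \<sigma>_pos[OF u])
    have "(u /\<^sub>R \<sigma> u) \<bullet> (S *v (u /\<^sub>R \<sigma> u)) = 1"
      using s by (simp add: matrix_vector_mult_scaleR field_simps)
    then have "\<sigma> (u /\<^sub>R \<sigma> u) = 1" by (simp only: real_sqrt_one)
    moreover have "H (u /\<^sub>R \<sigma> u) (a / \<sigma> u) = {y. u \<bullet> y \<le> a}"
      using s by (auto simp: H_def field_simps)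
    ultimately show "\<exists>A\<in>F. \<exists>B\<in>F. A \<subseteq> {y. u \<bullet> y \<le> a} \<and> {y. u \<bullet> y \<le> a} \<subseteq> B
       \<and> measure G B - measure G A \<le> \<eta>"
      using normalized[of "u /\<^sub>R \<sigma> u" "a / \<sigma> u"] by simp
  qed
qed

lemma HD_empirical_uniform_convergence:
  fixes M :: "'w measure" and X :: "nat \<Rightarrow> 'w \<Rightarrow> real^'n"
  assumes M: "prob_space M" and indep: "prob_space.indep_vars M (\<lambda>_. borel) X UNIV"
    and distr: "\<And>i. distr M borel (X i) = G" and \<eta>: "\<eta> > 0" and \<theta>: "\<theta> > 0"
  shows "\<exists>N. \<forall>n\<ge>N. \<exists>A\<in>sets M. measure M A < \<theta> \<and>
    (\<forall>\<omega>\<in>space M - A. \<forall>x. \<bar>HD (empirical n (\<lambda>i. X i \<omega>)) x - HD (measure G) x\<bar> \<le> \<eta>)"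
proof -
  interpret M: prob_space M by fact
  \<comment> \<open>One half pays for the bracket width, the other for the empirical deviation on
    the bracketing sets.\<close>
  define \<epsilon> where "\<epsilon> = \<eta> / 2"
  have \<epsilon>: "\<epsilon> > 0" using \<eta> by (simp add: \<epsilon>_def)
  obtain F where F: "finite F" "F \<subseteq> sets borel"
    "\<And>u a. u \<noteq> 0 \<Longrightarrow> \<exists>A\<in>F. \<exists>B\<in>F. A \<subseteq> {y. u \<bullet> y \<le> a} \<and> {y. u \<bullet> y \<le> a} \<subseteq> B
       \<and> measure G B - measure G A \<le> \<epsilon>"
    by (fact finite_halfspace_brackets[OF \<epsilon>])
  have "(\<lambda>n. real (card F) * (2 * exp (- 2 * \<epsilon>\<^sup>2) ^ n)) \<longlonglongrightarrow> real (card F) * (2 * 0)"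
    using \<epsilon> by (intro tendsto_intros LIMSEQ_realpow_zero) auto
  then have "\<forall>\<^sub>F n in sequentially. real (card F) * (2 * exp (- 2 * \<epsilon>\<^sup>2) ^ n) < \<theta>"
    by (rule order_tendstoD) (use \<theta> in simp)
  then obtain N where N: "\<And>n. n \<ge> N \<Longrightarrow> real (card F) * (2 * exp (- 2 * \<epsilon>\<^sup>2) ^ n) < \<theta>"
    by (auto simp: eventually_sequentially)
  show ?thesis
  \<comment> \<open>\<open>n > 0\<close> enters Hoeffding's bound and the direction
    \<open>u = 0\<close>, where the empirical mass of the whole space must be one.\<close>
  proof (intro exI[of _ "max 1 N"] allI impI)
    fix n assume "n \<ge> max 1 N"
    then have n: "n > 0" "n \<ge> N" by auto
    let ?E = "\<lambda>\<omega>. empirical n (\<lambda>i. X i \<omega>)"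
    define bad where "bad B = {\<omega> \<in> space M. \<bar>?E \<omega> B - measure G B\<bar> \<ge> \<epsilon>}" for B
    have bad: "bad B \<in> sets M" "measure M (bad B) \<le> 2 * exp (- 2 * \<epsilon>\<^sup>2) ^ n" if "B \<in> F" for B
    proof -
      have B: "B \<in> sets borel" using F(2) that by auto
      show "bad B \<in> sets M" unfolding bad_def
        by (rule M.empirical_deviation(2)[OF indep distr B n(1)]) (use \<epsilon> in simp)
      have "measure M (bad B) \<le> 2 * exp (- 2 * real n * \<epsilon>\<^sup>2)" unfolding bad_def
        by (rule M.empirical_deviation(1)[OF indep distr B n(1)]) (use \<epsilon> in simp)
      also have "exp (- 2 * real n * \<epsilon>\<^sup>2) = exp (- 2 * \<epsilon>\<^sup>2) ^ n"
        by (simp add: exp_of_nat_mult[symmetric] mult_ac)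
      finally show "measure M (bad B) \<le> 2 * exp (- 2 * \<epsilon>\<^sup>2) ^ n" .
    qed
    \<comment> \<open>A finite union of measurable events. Off \<open>A\<close> the bound holds for
      all \<open>x\<close> at once, so measurability of a supremum over \<open>x\<close> never
      arises.\<close>
    define A where "A = (\<Union>B\<in>F. bad B)"
    have "measure M A \<le> (\<Sum>B\<in>F. measure M (bad B))"
      unfolding A_def using bad F(1) by (intro M.finite_measure_subadditive_finite) auto
    also have "\<dots> \<le> (\<Sum>B\<in>F. 2 * exp (- 2 * \<epsilon>\<^sup>2) ^ n)" by (intro sum_mono bad)
    also have "\<dots> < \<theta>" using N[OF n(2)] by simp
    finally have "measure M A < \<theta>" .
    moreover have "A \<in> sets M" unfolding A_def using F(1) bad by auto
    moreover have "\<bar>HD (?E \<omega>) x - HD (measure G) x\<bar> \<le> \<eta>" if \<omega>: "\<omega> \<in> space M - A" for \<omega> x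
      unfolding HD_def
    proof (rule abs_INF_diff_le)
      show "bdd_below (range (\<lambda>u. ?E \<omega> {y. u \<bullet> y \<le> u \<bullet> x}))"
        by (intro bdd_belowI[of _ 0]) (auto simp: empirical_nonneg)
      show "bdd_below (range (\<lambda>u. measure G {y. u \<bullet> y \<le> u \<bullet> x}))"
        by (intro bdd_belowI[of _ 0]) auto
      fix u :: "real^'n"
      show "\<bar>?E \<omega> {y. u \<bullet> y \<le> u \<bullet> x} - measure G {y. u \<bullet> y \<le> u \<bullet> x}\<bar> \<le> \<eta>"
      proof (cases "u = 0")
        case True
        then show ?thesis using n(1) G.prob_space \<eta> by (simp add: empirical_UNIV)
      next
        case False
        let ?H = "{y. u \<bullet> y \<le> u \<bullet> x}"
        obtain L U where LU: "L \<in> F" "U \<in> F" "L \<subseteq> ?H" "?H \<subseteq> U" "measure G U - measure G L \<le> \<epsilon>"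
          using F(3)[OF False] by blast
        have dev: "\<bar>?E \<omega> B - measure G B\<bar> < \<epsilon>" if "B \<in> F" for B
          using \<omega> that by (auto simp: A_def bad_def not_le)
        have [measurable]: "?H \<in> sets borel" by measurable
        have "measure G L \<le> measure G ?H" "measure G ?H \<le> measure G U"
          using LU F(2) by (auto intro!: G.finite_measure_mono)
        moreover have "?E \<omega> L \<le> ?E \<omega> ?H" "?E \<omega> ?H \<le> ?E \<omega> U"
          using LU by (auto intro: empirical_mono)
        ultimately show ?thesis using dev[OF LU(1)] dev[OF LU(2)] LU(5) unfolding \<epsilon>_def by linarith
      qed
    qed
    ultimately show "\<exists>A\<in>sets M. measure M A < \<theta> \<and> (\<forall>\<omega>\<in>space M - A. \<forall>x. \<bar>HD (?E \<omega>) x - HD (measure G) x\<bar> \<le> \<eta>)"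
      by blast
  qed
qed

end

subsection \<open>Stability of the discriminant score\<close>

text \<open>\<open>vol\<close> is real-valued, with value 0 on sets of infinite or undefined
  measure; compactness keeps such values out of the comparison.\<close>

lemma vol_mono:
  assumes "A \<subseteq> B" "compact A" "compact B" shows "vol A \<le> vol B"
  unfolding vol_def
proof (rule measure_mono_fmeasurable[OF assms(1)])
  show "A \<in> sets lborel" using assms(2) by (simp add: borel_compact)
  show "B \<in> fmeasurable lborel"
    using assms(3) emeasure_compact_finite[OF assms(3)]
    by (intro fmeasurableI) (auto simp: borel_compact)
qed

lemma Ill_mono:
  assumes "A \<subseteq> B" "compact A" "compact B" shows "Ill x A \<le> Ill x B"
  unfolding Ill_def using assms
  by (intro vol_mono hull_mono compact_convex_hull compact_Un) auto

lemma vol_le_Ill: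
  assumes "compact A" shows "vol A \<le> Ill x A"
  unfolding Ill_def
  by (rule vol_mono) (use assms hull_subset[of "A \<union> {x}" convex] in \<open>auto intro!: compact_convex_hull\<close>)

text \<open>\<open>g_fun d\<close> on \<open>[1, \<infinity>)\<close>, continued by the identity so that it is strictly increasing on the whole line.\<close>

definition g_ext :: "nat \<Rightarrow> real \<Rightarrow> real" where
  "g_ext d t = (if t \<le> 1 then t else g_fun d t)"

lemma g_ext_eq: "t \<ge> 1 \<Longrightarrow> g_ext d t = g_fun d t"
  by (auto simp: g_ext_def g_fun_1)

lemma strict_mono_g_ext:
  assumes "d > 0" shows "strict_mono (g_ext d)"
proof (rule strict_monoI)
  fix s t :: real assume st: "s < t"
  show "g_ext d s < g_ext d t"
  proof (cases "s \<ge> 1")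
    case True
    then show ?thesis using st g_fun_strict_mono[OF True st assms] by (simp add: g_ext_eq)
  next
    case False
    then show ?thesis using st g_fun_mono[of 1 t d] assms by (auto simp: g_ext_def g_fun_1)
  qed
qed

lemma continuous_on_g_ext:
  assumes "d > 0" shows "continuous_on UNIV (g_ext d)"
proof -
  have "continuous_on ({..1} \<union> {1..}) (g_ext d)"
    unfolding g_ext_def
    using continuous_on_g_fun[OF assms] by (intro continuous_on_cases) (auto simp: g_fun_1)
  moreover have "{..1} \<union> {1..} = (UNIV :: real set)" by auto
  ultimately show ?thesis by simp
qed

lemma g_inv_eqI:
  assumes "t \<ge> 1" "g_fun d t = s" "d > 0" shows "g_inv d s = t"
  unfolding g_inv_def
proof (rule the_equality)
  fix t' assume t': "t' \<ge> 1 \<and> g_fun d t' = s"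
  then have "g_ext d t' = g_ext d t" using assms by (simp add: g_ext_eq)
  then show "t' = t" using strict_mono_eq[OF strict_mono_g_ext[OF assms(3)]] by blast
qed (use assms in simp)

context nondegenerate_gaussian
begin

text \<open>The deterministic half of the convergence, for an arbitrary set function
  \<open>Q\<close>. Half of \<open>\<epsilon>\<close> is spent on the logarithm of the volume, half
  on the squared distance.\<close>

lemma discriminant_score_stability:
  assumes \<delta>: "0 < \<delta>" "\<delta> < 1/2" and p: "p > 0" and K: "bounded K" and \<epsilon>: "\<epsilon> > 0"
  obtains \<eta> where "\<eta> > 0"
    "\<And>Q x. closed (depth_region Q \<delta>) \<Longrightarrow> (\<And>x. \<bar>HD Q x - HD (measure G) x\<bar> \<le> \<eta>) \<Longrightarrow> x \<in> K \<Longrightarrow>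
       \<bar>2 * ln (p / vol (depth_region Q \<delta>)) - (M_delta \<delta> Q x)\<^sup>2
          - (2 * ln (p / vol (depth_region (measure G) \<delta>)) - (m x)\<^sup>2)\<bar> \<le> \<epsilon>"
proof -
  define d where "d = CARD('n)"
  have d: "d > 0" by (simp add: d_def)
  obtain r where r: "r > 0" "Phi (- r) = \<delta>" "Phi_inv (1 - \<delta>) = r"
    using upper_normal_quantile[OF \<delta>] by blast
  have "compact ((\<lambda>x. m x) ` closure K)"
    using K by (intro compact_continuous_image continuous_on_mahal) (simp add: compact_closure)
  then have "bounded ((\<lambda>x. m x) ` closure K)" by (rule compact_imp_bounded)
  then obtain D where D0: "\<And>x. x \<in> closure K \<Longrightarrow> \<bar>m x\<bar> \<le> D" by (auto simp: bounded_iff)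
  define D1 where "D1 = max 1 D"
  have D: "m x \<le> D1" if "x \<in> K" for x
    using D0[of x] closure_subset that by (force simp: D1_def)
  have D1: "D1 \<ge> 1" by (simp add: D1_def)
  \<comment> \<open>If \<open>M_delta\<close> is within \<open>\<epsilon>1 \<le> 1\<close> of
    \<open>m x \<le> D1\<close>, the squares differ by at most
    \<open>\<epsilon>1 * (2 * D1 + 1)\<close>.\<close>
  define \<epsilon>1 where "\<epsilon>1 = min 1 (\<epsilon> / (2 * (2 * D1 + 1)))"
  have \<epsilon>1: "\<epsilon>1 > 0" "\<epsilon>1 \<le> 1" "\<epsilon>1 * (2 * D1 + 1) \<le> \<epsilon> / 2"
  proof -
    show "\<epsilon>1 > 0" "\<epsilon>1 \<le> 1" using \<epsilon> D1 by (auto simp: \<epsilon>1_def)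
    have "\<epsilon>1 * (2 * D1 + 1) \<le> \<epsilon> / (2 * (2 * D1 + 1)) * (2 * D1 + 1)"
      using D1 by (intro mult_right_mono) (auto simp: \<epsilon>1_def)
    also have "\<dots> = \<epsilon> / 2" using D1 by (simp add: field_simps)
    finally show "\<epsilon>1 * (2 * D1 + 1) \<le> \<epsilon> / 2" .
  qed
  \<comment> \<open>Tolerance for the inner branch of \<open>M_delta\<close>: points in the region
    of \<open>Q\<close> will satisfy \<open>m x \<le> hi \<le> 2 * r\<close>, whence the
    range.\<close>
  obtain \<kappa>1 where \<kappa>1: "\<kappa>1 > 0" "\<And>t s. t \<in> {- 2 * r..0} \<Longrightarrow> \<bar>s - Phi t\<bar> < \<kappa>1 \<Longrightarrow> \<exists>t'. Phi t' = s \<and> \<bar>t' - t\<bar> \<le> \<epsilon>1"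
    by (rule strict_mono_locally_onto[OF strict_mono_Phi continuous_on_Phi \<epsilon>1(1), of "- 2 * r" 0]) blast
  \<comment> \<open>For the outer branch \<open>T\<close> bounds the argument of
    \<open>g_fun\<close> on \<open>K\<close>; an error \<open>\<epsilon>1 / (2 * r)\<close> there
    becomes \<open>\<epsilon>1 / 2\<close> after multiplication by \<open>r\<close>.\<close>
  define T where "T = max 1 (D1 / r)"
  have "\<epsilon>1 / (2 * r) > 0" using \<epsilon>1 r by simp
  then obtain \<kappa>2 where \<kappa>2: "\<kappa>2 > 0"
    "\<And>t s. t \<in> {1..T} \<Longrightarrow> \<bar>s - g_ext d t\<bar> < \<kappa>2 \<Longrightarrow> \<exists>t'. g_ext d t' = s \<and> \<bar>t' - t\<bar> \<le> \<epsilon>1 / (2 * r)"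
    by (rule strict_mono_locally_onto[OF strict_mono_g_ext[OF d] continuous_on_g_ext[OF d], of _ 1 T]) blast
  \<comment> \<open>\<open>l\<close> is the factor between \<open>r\<close> and the radii of the
    enclosing ellipsoids. The last three conditions bound the logarithm of the volume ratio, the
    shift of points between \<open>lo\<close> and \<open>r\<close>, and the illumination quotient,
    which is off by at most a factor \<open>l ^ (2 * d)\<close>.\<close>
  obtain l where l: "l > 1" "l < 2" "2 * (real d * ln l) < \<epsilon> / 2" "r * (l - 1) < \<epsilon>1 / 2" "(l ^ (2 * d) - 1) * g_fun d T < \<kappa>2"
  proof -
    have lim: "((\<lambda>l. 2 * (real d * ln l)) \<longlongrightarrow> 2 * (real d * ln 1)) (at_right (1::real))"
      "((\<lambda>l. r * (l - 1)) \<longlongrightarrow> r * (1 - 1)) (at_right (1::real))"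
      "((\<lambda>l. (l ^ (2 * d) - 1) * g_fun d T) \<longlongrightarrow> (1 ^ (2 * d) - 1) * g_fun d T) (at_right (1::real))"
      by (intro tendsto_intros; simp)+
    have "\<forall>\<^sub>F l in at_right (1::real). 2 * (real d * ln l) < \<epsilon> / 2" "\<forall>\<^sub>F l in at_right (1::real). r * (l - 1) < \<epsilon>1 / 2"
      "\<forall>\<^sub>F l in at_right (1::real). (l ^ (2 * d) - 1) * g_fun d T < \<kappa>2"
      by (rule order_tendstoD(2)[OF lim(1)] order_tendstoD(2)[OF lim(2)] order_tendstoD(2)[OF lim(3)];
        use \<epsilon> \<epsilon>1(1) \<kappa>2(1) in simp)+
    moreover have "\<forall>\<^sub>F l in at_right (1::real). l \<in> {1<..<2}" by (rule eventually_at_right_real) simp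
    ultimately have "\<forall>\<^sub>F l in at_right (1::real). l \<in> {1<..<2} \<and> 2 * (real d * ln l) < \<epsilon> / 2 \<and> r * (l - 1) < \<epsilon>1 / 2 \<and> (l ^ (2 * d) - 1) * g_fun d T < \<kappa>2"
      by (simp add: eventually_conj_iff)
    then have "\<exists>l. l \<in> {1<..<2} \<and> 2 * (real d * ln l) < \<epsilon> / 2 \<and> r * (l - 1) < \<epsilon>1 / 2 \<and> (l ^ (2 * d) - 1) * g_fun d T < \<kappa>2"
      by (rule eventually_happens'[rotated]) simp
    then show ?thesis using that by auto
  qed
  define lo where "lo = r / l"
  define hi where "hi = r * l"
  have lohi: "0 < lo" "lo < r" "r < hi" "hi \<le> 2 * r"
    using r l by (auto simp: lo_def hi_def field_simps)
  \<comment> \<open>The depth gaps at \<open>lo\<close> and \<open>hi\<close> bound the admissible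
    error; halving makes the comparisons with \<open>hi\<close> and \<open>\<kappa>1\<close>
    strict.\<close>
  define \<eta> where "\<eta> = min (Phi (- lo) - \<delta>) (min ((\<delta> - Phi (- hi)) / 2) (\<kappa>1 / 2))"
  have gaps: "Phi (- lo) > \<delta>" "Phi (- hi) < \<delta>" using lohi unfolding r(2)[symmetric] by auto
  have \<eta>: "\<eta> > 0" "\<delta> + \<eta> \<le> Phi (- lo)" "Phi (- hi) < \<delta> - \<eta>" "\<eta> < \<kappa>1"
    using gaps \<kappa>1(1) by (auto simp: \<eta>_def min_def field_simps)
  show ?thesis
  proof (rule that[OF \<eta>(1)])
    fix Q x
    assume closed: "closed (depth_region Q \<delta>)"
      and HD: "\<And>x. \<bar>HD Q x - HD (measure G) x\<bar> \<le> \<eta>" and xK: "x \<in> K"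
    have HD': "\<bar>HD Q y - Phi (- m y)\<bar> \<le> \<eta>" for y using HD[of y] by (simp add: HD_gauss)
    define R where "R = depth_region Q \<delta>"
    have R_iff: "y \<in> R \<longleftrightarrow> HD Q y \<ge> \<delta>" for y by (simp add: R_def depth_region_def)
    have sub1: "ellipsoid lo \<subseteq> R"
    proof
      fix y assume "y \<in> ellipsoid lo"
      then have "Phi (- lo) \<le> Phi (- m y)" by (simp add: ellipsoid_def)
      then show "y \<in> R" using HD'[of y] \<eta> unfolding R_iff by linarith
    qed
    have sub2: "R \<subseteq> ellipsoid hi"
    proof
      fix y assume "y \<in> R"
      then have "Phi (- hi) < Phi (- m y)" using HD'[of y] \<eta> unfolding R_iff by linarith
      then show "y \<in> ellipsoid hi" by (simp add: ellipsoid_def)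
    qed
    have comp: "compact (ellipsoid lo)" "compact (ellipsoid hi)"
      using convex_compact_ellipsoid(2) lohi by auto
    have "bounded R" using sub2 comp compact_imp_bounded bounded_subset by blast
    then have compR: "compact R" using closed by (simp add: R_def compact_eq_bounded_closed)
    define V where "V = vol (ellipsoid r)"
    define b where "b = l ^ d"
    have b: "b \<ge> 1" "l ^ (2 * d) = b * b" using l by (auto simp: b_def power_mult power2_eq_square power_mult_distrib power_even_eq)
    have V: "V > 0" using vol_ellipsoid_pos r by (simp add: V_def)
    have Vlo: "vol (ellipsoid lo) = V / b" and Vhi: "vol (ellipsoid hi) = V * b"
      using lohi r(1) by (simp_all add: vol_ellipsoid V_def lo_def hi_def b_def d_def power_divide power_mult_distrib)
    have volR: "V / b \<le> vol R" "vol R \<le> V * b"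
      using vol_mono[OF sub1 comp(1) compR] vol_mono[OF sub2 compR comp(2)] Vlo Vhi by auto
    have "V / b > 0" using V b by simp
    then have Rpos: "vol R > 0" using volR by simp
    have "\<bar>2 * ln (p / vol R) - 2 * ln (p / V)\<bar> \<le> \<epsilon> / 2"
    proof -
      have lnb: "ln b = d * ln l" using l by (simp add: b_def ln_realpow)
      have "V * b > 0" using V b by simp
      then have "ln (V / b) \<le> ln (vol R)" "ln (vol R) \<le> ln (V * b)"
        using volR ln_le_cancel_iff[OF \<open>V / b > 0\<close> Rpos] ln_le_cancel_iff[OF Rpos] by blast+
      then have "ln V - ln b \<le> ln (vol R)" "ln (vol R) \<le> ln V + ln b"
        using V b by (auto simp: ln_div ln_mult)
      moreover have "2 * ln b < \<epsilon> / 2" using l(3) by (simp only: lnb)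
      ultimately have "\<bar>2 * (ln V - ln (vol R))\<bar> \<le> \<epsilon> / 2" by argo
      also have "2 * (ln V - ln (vol R)) = 2 * ln (p / vol R) - 2 * ln (p / V)"
        using p V Rpos by (simp add: ln_div)
      finally show ?thesis .
    qed
    moreover have M_close: "\<bar>M_delta \<delta> Q x - m x\<bar> \<le> \<epsilon>1"
    proof (cases "HD Q x \<ge> \<delta>")
      case True
      then have "x \<in> ellipsoid hi" using sub2 by (auto simp: R_iff)
      then have "- m x \<in> {- 2 * r..0}" using mahal_nonneg[of x] lohi by (simp add: ellipsoid_def)
      moreover have "\<bar>HD Q x - Phi (- m x)\<bar> < \<kappa>1" using HD'[of x] \<eta>(4) by linarith
      ultimately obtain t' where t': "Phi t' = HD Q x" "\<bar>t' - (- m x)\<bar> \<le> \<epsilon>1" using \<kappa>1(2) by blast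
      have "Phi_inv (1 - HD Q x) = - t'" by (rule Phi_inv_eqI) (simp add: Phi_uminus t')
      then have "M_delta \<delta> Q x = - t'" using True by (simp add: M_delta_def)
      then show ?thesis using t'(2) by linarith
    next
      case False
      then have "x \<notin> ellipsoid lo" using sub1 R_iff by blast
      then have mlo: "m x > lo" by (simp add: ellipsoid_def)
      define t where "t = max 1 (m x / r)"
      define s where "s = Ill x R / vol R"
      have tT: "t \<in> {1..T}" using D[OF xK] r by (auto simp: t_def T_def divide_right_mono le_max_iff_disj)
      have g1: "g_fun d t \<ge> 1" using g_fun_mono[of 1 t d] d by (simp add: t_def g_fun_1)
      have gT: "g_fun d t \<le> g_fun d T" using g_fun_mono[of t T d] tT d by simp
      have s1: "s \<ge> 1" using vol_le_Ill[OF compR, of x] Rpos by (simp add: s_def)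
      \<comment> \<open>\<open>g_fun\<close> is increasing, so replacing \<open>hi\<close> or
        \<open>lo\<close> by \<open>r\<close> in its argument goes in the favourable direction and
        only the volume factor \<open>b\<close> is lost.\<close>
      have quot: "m x / hi \<le> m x / r" "m x / r \<le> m x / lo"
        using mahal_nonneg[of x] lohi r(1) by (auto intro!: divide_left_mono)
      have "Ill x R \<le> Ill x (ellipsoid hi)" by (rule Ill_mono[OF sub2 compR comp(2)])
      also have "\<dots> = V * b * g_fun d (max 1 (m x / hi))"
        using lohi r(1) by (simp add: Ill_ellipsoid Vhi d_def)
      also have "\<dots> \<le> V * b * g_fun d t"
        using V b quot d by (intro mult_left_mono g_fun_mono) (auto simp: t_def max_def)
      finally have Ill_le: "Ill x R \<le> V * b * g_fun d t" .
      have "V / b * g_fun d t \<le> V / b * g_fun d (max 1 (m x / lo))"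
        using V b quot d by (intro mult_left_mono g_fun_mono) (auto simp: t_def max_def)
      also have "\<dots> = Ill x (ellipsoid lo)" using lohi by (simp add: Ill_ellipsoid Vlo d_def)
      also have "\<dots> \<le> Ill x R" by (rule Ill_mono[OF sub1 comp(1) compR])
      finally have Ill_ge: "V / b * g_fun d t \<le> Ill x R" .
      have s_le: "s \<le> b * b * g_fun d t"
      proof -
        have "s \<le> (V * b * g_fun d t) / (V / b)"
          unfolding s_def using Ill_le volR(1) V b g1 by (intro frac_le) auto
        then show ?thesis using V b by (simp add: mult_ac)
      qed
      have s_ge: "g_fun d t / (b * b) \<le> s"
      proof -
        have "(V / b * g_fun d t) / (V * b) \<le> s"
          unfolding s_def using Ill_ge volR(2) V b g1 Rpos vol_le_Ill[OF compR, of x] by (intro frac_le) auto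
        then show ?thesis using V b by (simp add: field_simps)
      qed
      have bb: "b * b \<ge> 1" using b by (simp add: mult_ge1_I)
      have small: "(b * b - 1) * g_fun d t < \<kappa>2"
      proof -
        have "(b * b - 1) * g_fun d t \<le> (b * b - 1) * g_fun d T" using gT bb by (intro mult_left_mono) auto
        then show ?thesis using l(5) unfolding b(2) by linarith
      qed
      have "\<bar>s - g_fun d t\<bar> < \<kappa>2"
      proof -
        have "s - g_fun d t \<le> (b * b - 1) * g_fun d t" using s_le by (simp add: algebra_simps)
        \<comment> \<open>\<open>1 - 1 / c \<le> c - 1\<close> for \<open>c \<ge> 1\<close> gives
          the lower deviation the same bound as the upper one.\<close>
        moreover have "g_fun d t - s \<le> (b * b - 1) * g_fun d t"
        proof -
          have "(c - 1) / c \<le> (c - 1) / 1" if "c \<ge> 1" for c :: real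
            using that by (intro divide_left_mono) auto
          from this[OF bb] have "1 - 1 / (b * b) \<le> b * b - 1"
            using b(1) by (simp add: diff_divide_distrib split: if_splits)
          then have "(1 - 1 / (b * b)) * g_fun d t \<le> (b * b - 1) * g_fun d t" using g1 by (intro mult_right_mono) auto
          then show ?thesis using s_ge by (simp add: algebra_simps)
        qed
        ultimately show ?thesis using small by linarith
      qed
      then have "\<bar>s - g_ext d t\<bar> < \<kappa>2" using tT by (simp add: g_ext_eq)
      then obtain t' where t': "g_ext d t' = s" "\<bar>t' - t\<bar> \<le> \<epsilon>1 / (2 * r)" using \<kappa>2(2)[OF tT] by blast
      \<comment> \<open>Below 1 \<open>g_ext\<close> is the identity, so a value
        \<open>s \<ge> 1\<close> has its preimage in the domain of \<open>g_fun\<close>.\<close>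
      have "t' \<ge> 1" using t'(1) s1 by (auto simp: g_ext_def split: if_splits)
      then have "g_inv d s = t'" using t'(1) d by (intro g_inv_eqI) (auto simp: g_ext_eq)
      then have M: "M_delta \<delta> Q x = r * t'"
        using False r(3) by (simp add: M_delta_def s_def R_def d_def)
      have "\<bar>r * t' - r * t\<bar> = r * \<bar>t' - t\<bar>" using r(1) by (simp add: abs_mult flip: right_diff_distrib)
      also have "\<dots> \<le> r * (\<epsilon>1 / (2 * r))" using r(1) t'(2) by (intro mult_left_mono) auto
      also have "\<dots> = \<epsilon>1 / 2" using r(1) by simp
      finally have 1: "\<bar>r * t' - r * t\<bar> \<le> \<epsilon>1 / 2" .
      \<comment> \<open>A point outside the region of \<open>Q\<close> may still have
        \<open>m x < r\<close>; then \<open>t = 1\<close>, and the discrepancy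
        \<open>r - m x\<close> is below \<open>r - lo\<close>.\<close>
      have rt: "r * t = max r (m x)" using r(1) by (auto simp: t_def max_def field_simps)
      have "r - lo \<le> r * (l - 1)"
      proof -
        have "r * (l - 1) - (r - lo) = r * (l - 1)\<^sup>2 / l" using l by (simp add: lo_def field_simps power2_eq_square)
        moreover have "\<dots> \<ge> 0" using l r(1) by simp
        ultimately show ?thesis by linarith
      qed
      then have 2: "\<bar>r * t - m x\<bar> \<le> \<epsilon>1 / 2" using rt mlo l(4) \<epsilon>1(1) by (auto simp: max_def)
      show ?thesis unfolding M using 1 2 by linarith
    qed
    have "\<bar>(M_delta \<delta> Q x)\<^sup>2 - (m x)\<^sup>2\<bar> \<le> \<epsilon> / 2"
    proof -
      have "\<bar>(M_delta \<delta> Q x)\<^sup>2 - (m x)\<^sup>2\<bar> = \<bar>M_delta \<delta> Q x - m x\<bar> * \<bar>M_delta \<delta> Q x + m x\<bar>"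
        unfolding abs_mult[symmetric] by (simp add: power2_eq_square algebra_simps)
      also have "\<dots> \<le> \<epsilon>1 * (2 * D1 + 1)"
        using M_close D[OF xK] mahal_nonneg[of x] \<epsilon>1(1,2) by (intro mult_mono) auto
      finally show ?thesis using \<epsilon>1(3) by linarith
    qed
    ultimately show "\<bar>2 * ln (p / vol (depth_region Q \<delta>)) - (M_delta \<delta> Q x)\<^sup>2
          - (2 * ln (p / vol (depth_region (measure G) \<delta>)) - (m x)\<^sup>2)\<bar> \<le> \<epsilon>"
      unfolding depth_region_gauss[OF r(2)] R_def[symmetric] V_def[symmetric] by linarith
  qed
qed

text \<open>\<open>sqrt (det S)\<close> occurs in the density and in the volume of the depth region
  alike. Once it cancels, the factor left over depends only on \<open>r\<close> and the dimension
  and is common to both classes.\<close>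

lemma weighted_density_eq:
  assumes r: "r > 0" "Phi (- r) = \<delta>" and p: "p > 0"
  shows "p * gauss_density mu S x = exp ((2 * ln (p / vol (depth_region (measure G) \<delta>)) - (m x)\<^sup>2) / 2)
        * (unit_ball_vol CARD('n) * r ^ CARD('n) / sqrt (2 * pi) ^ CARD('n))"
proof -
  let ?V = "vol (ellipsoid r)"
  define w where "w = unit_ball_vol CARD('n) * r ^ CARD('n)"
  have V: "?V = sqrt (det S) * w" "?V > 0" using vol_ellipsoid[OF r(1)] vol_ellipsoid_pos[OF r(1)] by (auto simp: w_def)
  have w: "w > 0" using r by (simp add: w_def)
  have "p * gauss_density mu S x = exp ((2 * ln (p / ?V) - (m x)\<^sup>2) / 2) * (w / sqrt (2 * pi) ^ CARD('n))"
  proof -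
    have "exp ((2 * ln (p / ?V) - (m x)\<^sup>2) / 2) = exp (ln (p / ?V)) * exp (- (m x)\<^sup>2 / 2)"
      by (simp add: exp_add[symmetric] diff_divide_distrib)
    also have "exp (ln (p / ?V)) = p / ?V" using V p by simp
    finally have "exp ((2 * ln (p / ?V) - (m x)\<^sup>2) / 2) * (w / sqrt (2 * pi) ^ CARD('n))
      = p / (sqrt (det S) * w) * exp (- (m x)\<^sup>2 / 2) * (w / sqrt (2 * pi) ^ CARD('n))" by (simp only: V(1))
    also have "\<dots> = p * (exp (- (m x)\<^sup>2 / 2) / (sqrt (2 * pi) ^ CARD('n) * sqrt (det S)))"
      using w by simp
    also have "sqrt (2 * pi) ^ CARD('n) * sqrt (det S) = sqrt ((2 * pi) ^ CARD('n) * det S)"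
      by (simp only: real_sqrt_mult real_sqrt_power)
    finally show ?thesis by (simp only: gauss_density_def)
  qed
  then show ?thesis unfolding depth_region_gauss[OF r(2)] w_def .
qed

text \<open>A supremum over an arbitrary bounded \<open>K\<close> might not be measurable, so the
  exceptional set is covered by an event \<open>A\<close>: convergence in outer probability.\<close>

lemma discriminant_score_in_probability:
  fixes M :: "'w measure" and X :: "nat \<Rightarrow> 'w \<Rightarrow> real^'n"
  assumes M: "prob_space M" and indep: "prob_space.indep_vars M (\<lambda>_. borel) X UNIV"
    and distr: "\<And>i. distr M borel (X i) = G"
    and \<delta>: "0 < \<delta>" "\<delta> < 1/2" and p: "p > 0" and K: "bounded K" and \<epsilon>: "\<epsilon> > 0" and \<theta>: "\<theta> > 0"
  shows "\<exists>N. \<forall>n\<ge>N. \<exists>A\<in>sets M. {\<omega> \<in> space M. \<exists>x\<in>K.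
      \<bar>2 * ln (p / vol (depth_region (empirical n (\<lambda>i. X i \<omega>)) \<delta>))
         - (M_delta \<delta> (empirical n (\<lambda>i. X i \<omega>)) x)\<^sup>2
         - (2 * ln (p / vol (depth_region (measure G) \<delta>)) - (m x)\<^sup>2)\<bar> > \<epsilon>} \<subseteq> A \<and> measure M A < \<theta>"
proof -
  obtain \<eta> where \<eta>: "\<eta> > 0"
    "\<And>Q x. closed (depth_region Q \<delta>) \<Longrightarrow> (\<And>x. \<bar>HD Q x - HD (measure G) x\<bar> \<le> \<eta>) \<Longrightarrow> x \<in> K \<Longrightarrow>
       \<bar>2 * ln (p / vol (depth_region Q \<delta>)) - (M_delta \<delta> Q x)\<^sup>2
          - (2 * ln (p / vol (depth_region (measure G) \<delta>)) - (m x)\<^sup>2)\<bar> \<le> \<epsilon>"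
    by (fact discriminant_score_stability[OF \<delta> p K \<epsilon>])
  obtain N where N: "\<And>n. n \<ge> N \<Longrightarrow> \<exists>A\<in>sets M. measure M A < \<theta> \<and>
    (\<forall>\<omega>\<in>space M - A. \<forall>x. \<bar>HD (empirical n (\<lambda>i. X i \<omega>)) x - HD (measure G) x\<bar> \<le> \<eta>)"
    using HD_empirical_uniform_convergence[OF M indep distr \<eta>(1) \<theta>] by blast
  show ?thesis
  proof (intro exI[of _ N] allI impI)
    fix n assume "n \<ge> N"
    from N[OF this] obtain A where A: "A \<in> sets M" "measure M A < \<theta>"
      "\<forall>\<omega>\<in>space M - A. \<forall>x. \<bar>HD (empirical n (\<lambda>i. X i \<omega>)) x - HD (measure G) x\<bar> \<le> \<eta>"
      by blast
    have ok: "\<bar>2 * ln (p / vol (depth_region (empirical n (\<lambda>i. X i \<omega>)) \<delta>))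
         - (M_delta \<delta> (empirical n (\<lambda>i. X i \<omega>)) x)\<^sup>2
         - (2 * ln (p / vol (depth_region (measure G) \<delta>)) - (m x)\<^sup>2)\<bar> \<le> \<epsilon>"
      if "\<omega> \<in> space M - A" "x \<in> K" for \<omega> x
      by (rule \<eta>(2)[OF closed_depth_region_empirical A(3)[rule_format, OF that(1)] that(2)])
    show "\<exists>A\<in>sets M. {\<omega> \<in> space M. \<exists>x\<in>K.
      \<bar>2 * ln (p / vol (depth_region (empirical n (\<lambda>i. X i \<omega>)) \<delta>))
         - (M_delta \<delta> (empirical n (\<lambda>i. X i \<omega>)) x)\<^sup>2
         - (2 * ln (p / vol (depth_region (measure G) \<delta>)) - (m x)\<^sup>2)\<bar> > \<epsilon>} \<subseteq> A \<and> measure M A < \<theta>"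
    proof (intro bexI[OF _ A(1)] conjI subsetI A(2))
      fix \<omega> assume \<omega>: "\<omega> \<in> {\<omega> \<in> space M. \<exists>x\<in>K.
      \<bar>2 * ln (p / vol (depth_region (empirical n (\<lambda>i. X i \<omega>)) \<delta>))
         - (M_delta \<delta> (empirical n (\<lambda>i. X i \<omega>)) x)\<^sup>2
         - (2 * ln (p / vol (depth_region (measure G) \<delta>)) - (m x)\<^sup>2)\<bar> > \<epsilon>}"
      show "\<omega> \<in> A"
      proof (rule ccontr)
        assume "\<omega> \<notin> A"
        then have "\<omega> \<in> space M - A" using \<omega> by simp
        from ok[OF this] \<omega> show False by fastforce
      qed
    qed
  qed
qed

end

theorem theorem8:
  fixes mu :: "nat \<Rightarrow> real^'n" and S :: "nat \<Rightarrow> real^'n^'n"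
    and p :: "nat \<Rightarrow> real" and \<delta> :: real
    and M :: "'w measure" and X :: "nat \<Rightarrow> nat \<Rightarrow> 'w \<Rightarrow> real^'n"
  assumes posdef: "\<And>j. j \<in> {1,2} \<Longrightarrow> pos_def_matrix (S j)"
    and ppos: "p 1 > 0" "p 2 > 0" and psum: "p 1 + p 2 = 1"
    and delta: "0 < \<delta>" "\<delta> < 1/2"
    and prob: "prob_space M"
    and indep: "\<And>j. j \<in> {1,2} \<Longrightarrow> prob_space.indep_vars M (\<lambda>_. borel) (X j) UNIV"
    and distr: "\<And>j i. j \<in> {1,2} \<Longrightarrow> distr M borel (X j i) = gauss_measure (mu j) (S j)"
  shows
    "(\<forall>x :: real^'n.
        (2 * ln (p 1 / vol (depth_region (measure (gauss_measure (mu 1) (S 1))) \<delta>))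
           - (mahal (S 1) x (mu 1))\<^sup>2
         > 2 * ln (p 2 / vol (depth_region (measure (gauss_measure (mu 2) (S 2))) \<delta>))
           - (mahal (S 2) x (mu 2))\<^sup>2)
        \<longleftrightarrow> p 1 * gauss_density (mu 1) (S 1) x > p 2 * gauss_density (mu 2) (S 2) x)
     \<and>
     (\<forall>K :: (real^'n) set. \<forall>j \<in> {1,2}. bounded K \<longrightarrow>
        (\<forall>\<epsilon>>0. \<forall>\<eta>>0. \<exists>N. \<forall>n\<ge>N. \<exists>A \<in> sets M.
           {\<omega> \<in> space M. \<exists>x\<in>K.
              \<bar>2 * ln (p j / vol (depth_region (empirical n (\<lambda>i. X j i \<omega>)) \<delta>))
                 - (M_delta \<delta> (empirical n (\<lambda>i. X j i \<omega>)) x)\<^sup>2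
               - (2 * ln (p j / vol (depth_region (measure (gauss_measure (mu j) (S j))) \<delta>))
                  - (mahal (S j) x (mu j))\<^sup>2)\<bar> > \<epsilon>} \<subseteq> A
           \<and> measure M A < \<eta>))"
proof -
  have gauss: "nondegenerate_gaussian (mu j) (S j)" if j: "j \<in> {1,2}" for j
  proof (rule nondegenerate_gaussian.intro)
    show "pos_def_matrix (S j)" by (rule posdef[OF j])
    \<comment> \<open>Normalization of the Gaussian density is read off from the law of
      \<open>X j 0\<close>.\<close>
    have "X j 0 \<in> borel_measurable M"
      using indep[OF j] prob by (simp add: prob_space.indep_vars_def)
    then show "prob_space (gauss_measure (mu j) (S j))"
      using prob_space.prob_space_distr[OF prob] distr[OF j, of 0] by metis
  qed
  have bayes: "(2 * ln (p 1 / vol (depth_region (measure (gauss_measure (mu 1) (S 1))) \<delta>))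
           - (mahal (S 1) x (mu 1))\<^sup>2
         > 2 * ln (p 2 / vol (depth_region (measure (gauss_measure (mu 2) (S 2))) \<delta>))
           - (mahal (S 2) x (mu 2))\<^sup>2)
        \<longleftrightarrow> p 1 * gauss_density (mu 1) (S 1) x > p 2 * gauss_density (mu 2) (S 2) x" for x :: "real^'n"
  proof -
    let ?s = "\<lambda>j. 2 * ln (p j / vol (depth_region (measure (gauss_measure (mu j) (S j))) \<delta>)) - (mahal (S j) x (mu j))\<^sup>2"
    \<comment> \<open>\<open>r\<close> depends on \<open>\<delta>\<close> only, so both classes
      share the factor \<open>?c\<close>.\<close>
    obtain r where r: "r > 0" "Phi (- r) = \<delta>"
      using upper_normal_quantile[OF delta] by blast
    let ?c = "unit_ball_vol CARD('n) * r ^ CARD('n) / sqrt (2 * pi) ^ CARD('n)"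
    have c: "?c > 0" using r by simp
    have half: "a / 2 < b / 2 \<longleftrightarrow> a < b" for a b :: real by simp
    have eq: "p j * gauss_density (mu j) (S j) x = exp (?s j / 2) * ?c" if j: "j \<in> {1,2}" for j
      using j ppos by (intro nondegenerate_gaussian.weighted_density_eq[OF gauss[OF j] r]) auto
    have "p 1 * gauss_density (mu 1) (S 1) x > p 2 * gauss_density (mu 2) (S 2) x \<longleftrightarrow> exp (?s 1 / 2) > exp (?s 2 / 2)"
      using c by (simp only: eq insert_iff simp_thms mult_less_cancel_right_pos)
    also have "\<dots> \<longleftrightarrow> ?s 1 > ?s 2" by (simp only: exp_less_cancel_iff half)
    finally show ?thesis by blast
  qed
  have conv: "\<exists>N. \<forall>n\<ge>N. \<exists>A \<in> sets M.
           {\<omega> \<in> space M. \<exists>x\<in>K.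
              \<bar>2 * ln (p j / vol (depth_region (empirical n (\<lambda>i. X j i \<omega>)) \<delta>))
                 - (M_delta \<delta> (empirical n (\<lambda>i. X j i \<omega>)) x)\<^sup>2
               - (2 * ln (p j / vol (depth_region (measure (gauss_measure (mu j) (S j))) \<delta>))
                  - (mahal (S j) x (mu j))\<^sup>2)\<bar> > \<epsilon>} \<subseteq> A
           \<and> measure M A < \<eta>"
    if j: "j \<in> {1, 2}" and "bounded K" "\<epsilon> > 0" "\<eta> > 0" for K :: "(real^'n) set" and j and \<epsilon> \<eta> :: real
  proof -
    have "p j > 0" using j ppos by auto
    then show ?thesis
      using that(2-4)
      by (rule nondegenerate_gaussian.discriminant_score_in_probability
        [OF gauss[OF j] prob indep[OF j] distr[OF j] delta])
  qed
  show ?thesis using bayes conv by (intro conjI allI ballI impI)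
qed

end
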